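(* Let $(D,\Sigma)$ be a strongly recursive tropical linear series of rank $r$ on a metric graph $\Gamma$, and let $E$ be an effective divisor with $\deg E\le r$. If $f\in\Sigma$ satisfies $\rho_v(f)\ge E(v)$ for all $v\in\Gamma$ (the local rank property for $E$), then $\mathrm{div}(f)+D\ge E$ (the Baker–Norine rank property for $E$).
   Context: Metric graphs and functions. A metric graph is obtained from a finite connected graph by identifying each edge with a closed interval of positive length. $T_v(\Gamma)$ is the set of outgoing tangent directions. $\mathrm{sl}_\eta(f)$ is the outgoing slope of a continuous piecewise linear integer-slope function $f$. We set $\mathrm{div}(f)=\sum_v(-\sum_{\eta\in T_v}\mathrm{sl}_\eta(f))v$ and $R(D)=\{f:D+\mathrm{div}(f)\ge0\}$. Tropical linear series. A tropical linear series of rank $r$ is $(D,\Sigma)$ with $\Sigma\subseteq R(D)$ a finitely generated tropical submodule (closed under $\min\{f_i+a_i\}$) such that: (1) every effective $E$ of degree $r$ admits $f\in\Sigma$ with $\mathrm{div}(f)+D\ge E$; (2) every $r+2$ functions are tropically dependent (some $\min_i(f_i+a_i)$ is attained at least twice everywhere). It is strongly recursive (recursively in $r$) if: (3) every $r$ functions lie in a strongly recursive subseries of rank $r-1$; (4) for $S_1,S_2\subseteq\Sigma$ of sizes $s_1,s_2\le r$ with $s_1+s_2\ge r+2$, there are strongly recursive subseries $\Sigma_i\supseteq S_i$ of ranks $s_i-1$ whose intersection contains a strongly recursive series of rank $s_1+s_2-r-2$. Local arrays. Each slope set $\{\mathrm{sl}_\eta(f):f\in\Sigma\}$ has exactly $r+1$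 elements $s_\eta[0]<\dots<s_\eta[r]$. Fix at each $v$ of valence $d$ an ordering $\eta_1,\dots,\eta_d$. The local array is $M_v=\{\mathbf x\in[r]^d:\exists f\in\Sigma,\ \mathrm{sl}_{\eta_i}(f)=s_{\eta_i}[x_i]\ \forall i\}$, where $[r]=\{0,\dots,r\}$; such $\mathbf x$ and $f$ are associated. Permutation arrays and rank arrays. $[r]^d$ is ordered coordinatewise. For $P\subseteq[r]^d$, $P$ is rankable of rank $s$ if each coordinate takes exactly $s+1$ distinct values on $P$. $P$ is totally rankable if every $P[\mathbf x]=\{\mathbf y\in P:\mathbf y\succeq\mathbf x\}$ is rankable, and then its rank array is $\rho_P(\mathbf x)=\mathrm{rank}\,P[\mathbf x]$ (equal to $-1$ if $P[\mathbf x]=\emptyset$). Redundant points are coordinatewise minima of at least two elements of $P$ each sharing a coordinate with the point. A permutation array is a totally rankable $P$ of rank $r$ with no redundant points, and $\overline P$ adds its redundant points. For a strongly recursive tropical linear series each $M_v$ equals $\overline{P_v}$ for a unique permutation array $P_v$ of rank $r$ and dimension $d$. Local rank. For $f\in\Sigma$ associated to $\mathbf x\in M_v$, define $\rho_v(f)=\rho_{P_v}(\mathbf x)$. *)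

theory Defs
  imports Complex_Main
begin

section \<open>Metric graphs\<close>

text \<open>A finite connected (multi)graph, loops allowed, with positive edge lengths.
  Edge e is identified with the interval [0, len e], 0 being src e and len e being tgt e.\<close>

record ('v, 'e) mgraph =
  verts :: "'v set"
  edges :: "'e set"
  src :: "'e \<Rightarrow> 'v"
  tgt :: "'e \<Rightarrow> 'v"
  len :: "'e \<Rightarrow> real"

definition adj :: "('v, 'e) mgraph \<Rightarrow> ('v \<times> 'v) set" where
  "adj G = {(src G e, tgt G e) | e. e \<in> edges G} \<union> {(tgt G e, src G e) | e. e \<in> edges G}"

definition metric_graph :: "('v, 'e) mgraph \<Rightarrow> bool" where
  "metric_graph G \<longleftrightarrow> finite (verts G) \<and> finite (edges G) \<and> verts G \<noteq> {} \<and>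
     (\<forall>e\<in>edges G. src G e \<in> verts G \<and> tgt G e \<in> verts G \<and> len G e > 0) \<and>
     (\<forall>u\<in>verts G. \<forall>w\<in>verts G. (u, w) \<in> (adj G)\<^sup>*)"

text \<open>Points of the metric graph: vertices, and interior points of edges.\<close>
datatype ('v, 'e) gpt = Vtx 'v | Inn 'e real

definition pts :: "('v, 'e) mgraph \<Rightarrow> ('v, 'e) gpt set" where
  "pts G = Vtx ` verts G \<union> {Inn e t | e t. e \<in> edges G \<and> 0 < t \<and> t < len G e}"

text \<open>The point of edge e at parameter t in [0, len e].\<close>
definition epos :: "('v, 'e) mgraph \<Rightarrow> 'e \<Rightarrow> real \<Rightarrow> ('v, 'e) gpt" where
  "epos G e t = (if t = 0 then Vtx (src G e) else if t = len G e then Vtx (tgt G e) else Inn e t)"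

text \<open>Tangent directions: (e, t, True) leaves the point at parameter t of edge e in the
  increasing direction, (e, t, False) in the decreasing direction.\<close>
type_synonym 'e tdir = "'e \<times> real \<times> bool"

fun tdirs :: "('v, 'e) mgraph \<Rightarrow> ('v, 'e) gpt \<Rightarrow> 'e tdir set" where
  "tdirs G (Vtx v) = {(e, 0, True) | e. e \<in> edges G \<and> src G e = v}
                    \<union> {(e, len G e, False) | e. e \<in> edges G \<and> tgt G e = v}"
| "tdirs G (Inn e t) = {(e, t, True), (e, t, False)}"

section \<open>Piecewise linear functions with integer slopes\<close>

definition pl_int_on :: "real \<Rightarrow> real \<Rightarrow> (real \<Rightarrow> real) \<Rightarrow> bool" where
  "pl_int_on a b g \<longleftrightarrow> (\<exists>xs :: real list. \<exists>ms :: int list.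
      length xs \<ge> 2 \<and> sorted_wrt (<) xs \<and> hd xs = a \<and> last xs = b \<and>
      length ms = length xs - 1 \<and>
      (\<forall>i < length ms. \<forall>t \<in> {xs ! i .. xs ! Suc i}.
          g t = g (xs ! i) + of_int (ms ! i) * (t - xs ! i)))"

text \<open>Functions on the metric graph (normalised to 0 outside the graph, so that functions are
  determined by their values on the graph).  Continuity is automatic: the restriction to each
  closed edge is continuous and endpoint values are the vertex values.\<close>
definition pl_fun :: "('v, 'e) mgraph \<Rightarrow> (('v, 'e) gpt \<Rightarrow> real) \<Rightarrow> bool" where
  "pl_fun G f \<longleftrightarrow> (\<forall>e\<in>edges G. pl_int_on 0 (len G e) (\<lambda>t. f (epos G e t))) \<and>
                    (\<forall>p. p \<notin> pts G \<longrightarrow> f p = 0)"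

text \<open>Outgoing slope along a tangent direction.\<close>
fun sl :: "('v, 'e) mgraph \<Rightarrow> (('v, 'e) gpt \<Rightarrow> real) \<Rightarrow> 'e tdir \<Rightarrow> real" where
  "sl G f (e, t, b) =
     Lim (at_right 0) (\<lambda>h. (f (epos G e (if b then t + h else t - h)) - f (epos G e t)) / h)"

definition divf :: "('v, 'e) mgraph \<Rightarrow> (('v, 'e) gpt \<Rightarrow> real) \<Rightarrow> ('v, 'e) gpt \<Rightarrow> real" where
  "divf G f p = - (\<Sum>\<eta>\<in>tdirs G p. sl G f \<eta>)"

section \<open>Divisors\<close>

definition is_divisor :: "('v, 'e) mgraph \<Rightarrow> (('v, 'e) gpt \<Rightarrow> int) \<Rightarrow> bool" where
  "is_divisor G D \<longleftrightarrow> finite {p. D p \<noteq> 0} \<and> {p. D p \<noteq> 0} \<subseteq> pts G"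

definition deg :: "(('v, 'e) gpt \<Rightarrow> int) \<Rightarrow> int" where
  "deg D = (\<Sum>p\<in>{p. D p \<noteq> 0}. D p)"

definition effective :: "('v, 'e) mgraph \<Rightarrow> (('v, 'e) gpt \<Rightarrow> int) \<Rightarrow> bool" where
  "effective G E \<longleftrightarrow> is_divisor G E \<and> (\<forall>p. E p \<ge> 0)"

text \<open>div(f) + D \<ge> E\<close>
definition div_ge :: "('v, 'e) mgraph \<Rightarrow> (('v, 'e) gpt \<Rightarrow> int) \<Rightarrow> (('v, 'e) gpt \<Rightarrow> real)
                        \<Rightarrow> (('v, 'e) gpt \<Rightarrow> int) \<Rightarrow> bool" where
  "div_ge G D f E \<longleftrightarrow> (\<forall>p\<in>pts G. real_of_int (D p) + divf G f p \<ge> real_of_int (E p))"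

definition RR :: "('v, 'e) mgraph \<Rightarrow> (('v, 'e) gpt \<Rightarrow> int) \<Rightarrow> (('v, 'e) gpt \<Rightarrow> real) set" where
  "RR G D = {f. pl_fun G f \<and> div_ge G D f (\<lambda>_. 0)}"

section \<open>Tropical linear series\<close>

text \<open>Tropical submodule generated by a set of functions: all min_i (g_i + a_i).\<close>
definition tspan :: "('v, 'e) mgraph \<Rightarrow> (('v, 'e) gpt \<Rightarrow> real) set \<Rightarrow> (('v, 'e) gpt \<Rightarrow> real) set" where
  "tspan G Gs = {(\<lambda>p. if p \<in> pts G then Min ((\<lambda>g. g p + a g) ` H) else 0) | H a.
                   H \<subseteq> Gs \<and> finite H \<and> H \<noteq> {}}"

definition tdep :: "('v, 'e) mgraph \<Rightarrow> (('v, 'e) gpt \<Rightarrow> real) set \<Rightarrow> bool" where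
  "tdep G F \<longleftrightarrow> (\<exists>a :: (('v, 'e) gpt \<Rightarrow> real) \<Rightarrow> real. \<forall>p\<in>pts G. \<exists>g1\<in>F. \<exists>g2\<in>F. g1 \<noteq> g2 \<and>
       g1 p + a g1 = Min ((\<lambda>g. g p + a g) ` F) \<and> g2 p + a g2 = Min ((\<lambda>g. g p + a g) ` F))"

definition tls :: "('v, 'e) mgraph \<Rightarrow> nat \<Rightarrow> (('v, 'e) gpt \<Rightarrow> int)
                     \<Rightarrow> (('v, 'e) gpt \<Rightarrow> real) set \<Rightarrow> bool" where
  "tls G r D S \<longleftrightarrow> is_divisor G D \<and> S \<subseteq> RR G D \<and>
     (\<exists>Gs. finite Gs \<and> S = tspan G Gs) \<and>
     (\<forall>E. effective G E \<and> deg E = int r \<longrightarrow> (\<exists>f\<in>S. div_ge G D f E)) \<and>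
     (\<forall>F. F \<subseteq> S \<and> finite F \<and> card F = r + 2 \<longrightarrow> tdep G F)"

inductive strongly_recursive :: "('v, 'e) mgraph \<Rightarrow> nat \<Rightarrow> (('v, 'e) gpt \<Rightarrow> int)
                     \<Rightarrow> (('v, 'e) gpt \<Rightarrow> real) set \<Rightarrow> bool" for G where
  "\<lbrakk> tls G r D S;
     r \<ge> 1 \<longrightarrow> (\<forall>F. F \<subseteq> S \<and> finite F \<and> card F = r \<longrightarrow>
                    (\<exists>T. F \<subseteq> T \<and> T \<subseteq> S \<and> strongly_recursive G (r - 1) D T));
     \<forall>S1 S2. S1 \<subseteq> S \<and> S2 \<subseteq> S \<and> finite S1 \<and> finite S2 \<and> card S1 \<le> r \<and> card S2 \<le> r \<and>
             card S1 + card S2 \<ge> r + 2 \<longrightarrow>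
       (\<exists>T1 T2 T3. S1 \<subseteq> T1 \<and> T1 \<subseteq> S \<and> strongly_recursive G (card S1 - 1) D T1 \<and>
                   S2 \<subseteq> T2 \<and> T2 \<subseteq> S \<and> strongly_recursive G (card S2 - 1) D T2 \<and>
                   T3 \<subseteq> T1 \<inter> T2 \<and> strongly_recursive G (card S1 + card S2 - r - 2) D T3) \<rbrakk>
   \<Longrightarrow> strongly_recursive G r D S"

section \<open>Permutation arrays and rank arrays\<close>

text \<open>Arrays in [r]^d are represented as functions from the index set T (the tangent directions,
  d = card T) to {0..r}, extended by 0 outside T.\<close>
definition arr :: "nat \<Rightarrow> 'i set \<Rightarrow> ('i \<Rightarrow> nat) set" where
  "arr r T = {x. (\<forall>i\<in>T. x i \<le> r) \<and> (\<forall>i. i \<notin> T \<longrightarrow> x i = 0)}"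

definition cle :: "'i set \<Rightarrow> ('i \<Rightarrow> nat) \<Rightarrow> ('i \<Rightarrow> nat) \<Rightarrow> bool" where
  "cle T x y \<longleftrightarrow> (\<forall>i\<in>T. x i \<le> y i)"

definition upset :: "'i set \<Rightarrow> ('i \<Rightarrow> nat) set \<Rightarrow> ('i \<Rightarrow> nat) \<Rightarrow> ('i \<Rightarrow> nat) set" where
  "upset T P x = {y \<in> P. cle T x y}"

definition rankable :: "'i set \<Rightarrow> ('i \<Rightarrow> nat) set \<Rightarrow> int \<Rightarrow> bool" where
  "rankable T P s \<longleftrightarrow> (\<forall>i\<in>T. int (card ((\<lambda>y. y i) ` P)) = s + 1)"

definition rk :: "'i set \<Rightarrow> ('i \<Rightarrow> nat) set \<Rightarrow> int" where
  "rk T P = (THE s. rankable T P s)"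

definition totally_rankable :: "nat \<Rightarrow> 'i set \<Rightarrow> ('i \<Rightarrow> nat) set \<Rightarrow> bool" where
  "totally_rankable r T P \<longleftrightarrow> (\<forall>x\<in>arr r T. \<exists>s. rankable T (upset T P x) s)"

definition rank_array :: "'i set \<Rightarrow> ('i \<Rightarrow> nat) set \<Rightarrow> ('i \<Rightarrow> nat) \<Rightarrow> int" where
  "rank_array T P x = rk T (upset T P x)"

text \<open>Redundant point: coordinatewise minimum of at least two (other) elements of P, each of
  which shares a coordinate with it.\<close>
definition redundant :: "nat \<Rightarrow> 'i set \<Rightarrow> ('i \<Rightarrow> nat) set \<Rightarrow> ('i \<Rightarrow> nat) \<Rightarrow> bool" where
  "redundant r T P y \<longleftrightarrow> y \<in> arr r T \<and>
     (\<exists>Q. Q \<subseteq> P \<and> finite Q \<and> card Q \<ge> 2 \<and> y \<notin> Q \<and>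
          (\<forall>i\<in>T. y i = Min ((\<lambda>q. q i) ` Q)) \<and> (\<forall>q\<in>Q. \<exists>i\<in>T. q i = y i))"

definition perm_array :: "nat \<Rightarrow> 'i set \<Rightarrow> ('i \<Rightarrow> nat) set \<Rightarrow> bool" where
  "perm_array r T P \<longleftrightarrow> P \<subseteq> arr r T \<and> totally_rankable r T P \<and> rankable T P (int r) \<and>
     (\<forall>y\<in>P. \<not> redundant r T P y)"

definition pclosure :: "nat \<Rightarrow> 'i set \<Rightarrow> ('i \<Rightarrow> nat) set \<Rightarrow> ('i \<Rightarrow> nat) set" where
  "pclosure r T P = P \<union> {y. redundant r T P y}"

section \<open>Local arrays and local rank\<close>

definition slset :: "('v, 'e) mgraph \<Rightarrow> (('v, 'e) gpt \<Rightarrow> real) set \<Rightarrow> 'e tdir \<Rightarrow> real set" where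
  "slset G S \<eta> = (\<lambda>g. sl G g \<eta>) ` S"

text \<open>The element of [r]^{T_v} associated to f: coordinate \<eta> is the index of sl_\<eta>(f) in the
  increasingly ordered slope set.\<close>
definition assoc_pt :: "('v, 'e) mgraph \<Rightarrow> (('v, 'e) gpt \<Rightarrow> real) set \<Rightarrow> ('v, 'e) gpt
                        \<Rightarrow> (('v, 'e) gpt \<Rightarrow> real) \<Rightarrow> 'e tdir \<Rightarrow> nat" where
  "assoc_pt G S p f = (\<lambda>\<eta>. if \<eta> \<in> tdirs G p then card {s \<in> slset G S \<eta>. s < sl G f \<eta>} else 0)"

definition local_array :: "('v, 'e) mgraph \<Rightarrow> (('v, 'e) gpt \<Rightarrow> real) set \<Rightarrow> ('v, 'e) gpt
                           \<Rightarrow> ('e tdir \<Rightarrow> nat) set" where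
  "local_array G S p = assoc_pt G S p ` S"

definition local_perm_array :: "('v, 'e) mgraph \<Rightarrow> nat \<Rightarrow> (('v, 'e) gpt \<Rightarrow> real) set
                                \<Rightarrow> ('v, 'e) gpt \<Rightarrow> ('e tdir \<Rightarrow> nat) set" where
  "local_perm_array G r S p = (THE P. perm_array r (tdirs G p) P \<and>
                                       local_array G S p = pclosure r (tdirs G p) P)"

definition local_rank :: "('v, 'e) mgraph \<Rightarrow> nat \<Rightarrow> (('v, 'e) gpt \<Rightarrow> real) set
                          \<Rightarrow> ('v, 'e) gpt \<Rightarrow> (('v, 'e) gpt \<Rightarrow> real) \<Rightarrow> int" where
  "local_rank G r S p f = rank_array (tdirs G p) (local_perm_array G r S p) (assoc_pt G S p f)"

end

theory Submission
  imports Defs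
begin

text \<open>The claim is local: \<open>D(p) + div(f)(p) \<ge> \<rho>\<^sub>p(f)\<close>.  For a vector \<open>c\<close> of slopes at \<open>p\<close>, let
  \<open>N\<close> be the set of functions of the series whose slopes at \<open>p\<close> are at least \<open>c\<close>.  If \<open>N\<close>
  attains all \<open>r + 1\<close> slopes in one direction, then \<open>N\<close> is the whole series: any function outside \<open>N\<close>
  would be tropically dependent on functions of \<open>N\<close> with distinct slopes in that direction, which is
  impossible at \<open>p\<close>.  Otherwise functions realising all slopes of \<open>N\<close> in that direction lie in a
  strongly recursive subseries of rank \<open>r - 1\<close>.  Descending in this way shows that \<open>N\<close> attains the
  same number \<open>k + 1\<close> of slopes in every direction, so the local array is totally rankable, and that
  \<open>N\<close> contains a subseries of rank at least \<open>k\<close>, hence some \<open>g\<close> with \<open>D(p) + div(g)(p) \<ge> k\<close>.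
  For \<open>c\<close> the slopes of \<open>f\<close>, \<open>k\<close> is the local rank and \<open>div(f)(p) \<ge> div(g)(p)\<close>.\<close>

section \<open>Germs along tangent directions\<close>

text \<open>Points are parametrised by the distance \<open>h\<close> from the base point, so both
  orientations of an edge are handled by the one filter \<open>at_right 0\<close>.\<close>

definition ray :: "('v, 'e) mgraph \<Rightarrow> 'e tdir \<Rightarrow> real \<Rightarrow> ('v, 'e) gpt" where
  "ray G \<eta> h = (case \<eta> of (e, t, b) \<Rightarrow> epos G e (if b then t + h else t - h))"

lemma sl_eq_Lim_ray: "sl G f \<eta> = Lim (at_right 0) (\<lambda>h. (f (ray G \<eta> h) - f (ray G \<eta> 0)) / h)"
  by (cases \<eta>) (auto simp: ray_def)

text \<open>\<open>Lim\<close> carries information only once convergence is known; an affine germ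
  makes the difference quotient eventually constant.\<close>

lemma sl_eqI:
  assumes "eventually (\<lambda>h. f (ray G \<eta> h) = f (ray G \<eta> 0) + m * h) (at_right 0)"
  shows "sl G f \<eta> = m"
proof -
  have "eventually (\<lambda>h. (f (ray G \<eta> h) - f (ray G \<eta> 0)) / h = m) (at_right (0::real))"
    using assms eventually_at_right_less[of 0] by eventually_elim auto
  then have "((\<lambda>h. (f (ray G \<eta> h) - f (ray G \<eta> 0)) / h) \<longlongrightarrow> m) (at_right 0)"
    by (rule tendsto_eventually)
  then show ?thesis
    unfolding sl_eq_Lim_ray by (intro tendsto_Lim) auto
qed

lemma epos_in_pts:
  assumes "metric_graph G" "e \<in> edges G" "0 \<le> t" "t \<le> len G e"
  shows "epos G e t \<in> pts G"
  using assms by (auto simp: metric_graph_def epos_def pts_def)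

text \<open>Brings vertices and interior points into one form: a parameter on an edge with room left
  to move in the chosen direction.\<close>

lemma tdirs_cases:
  assumes "metric_graph G" "p \<in> pts G" "\<eta> \<in> tdirs G p"
  obtains e t b where "\<eta> = (e, t, b)" "e \<in> edges G" "0 \<le> t" "t \<le> len G e"
    "b \<Longrightarrow> t < len G e" "\<not> b \<Longrightarrow> 0 < t" "epos G e t = p"
proof (cases p)
  case (Vtx v)
  with assms consider e where "\<eta> = (e, 0, True)" "e \<in> edges G" "src G e = v"
    | e where "\<eta> = (e, len G e, False)" "e \<in> edges G" "tgt G e = v" by auto
  then show ?thesis
  proof cases
    case 1
    moreover have "0 < len G e" using assms(1) 1 by (auto simp: metric_graph_def)
    ultimately show ?thesis using Vtx by (intro that[of e 0 True]) (auto simp: epos_def)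
  next
    case 2
    moreover have "0 < len G e" using assms(1) 2 by (auto simp: metric_graph_def)
    ultimately show ?thesis using Vtx by (intro that[of e "len G e" False]) (auto simp: epos_def)
  qed
next
  case (Inn e t)
  with assms have "e \<in> edges G" "0 < t" "t < len G e" by (auto simp: pts_def)
  moreover obtain b where "\<eta> = (e, t, b)" using assms(3) Inn by auto
  ultimately show ?thesis using Inn by (intro that[of e t b]) (auto simp: epos_def)
qed

lemma finite_tdirs: "metric_graph G \<Longrightarrow> finite (tdirs G p)"
  by (cases p) (auto simp: metric_graph_def)

lemma ray_0:
  assumes "metric_graph G" "p \<in> pts G" "\<eta> \<in> tdirs G p"
  shows "ray G \<eta> 0 = p"
  by (rule tdirs_cases[OF assms]) (simp add: ray_def)

lemma eventually_at_right_0_less: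
  "(d::real) > 0 \<Longrightarrow> eventually (\<lambda>h. 0 < h \<and> h < d) (at_right 0)"
  unfolding eventually_at_right_field by (intro exI[of _ d]) auto

lemma eventually_ray_in_pts:
  assumes "metric_graph G" "p \<in> pts G" "\<eta> \<in> tdirs G p"
  shows "eventually (\<lambda>h. ray G \<eta> h \<in> pts G) (at_right 0)"
proof -
  obtain e t b where *: "\<eta> = (e, t, b)" "e \<in> edges G" "0 \<le> t" "t \<le> len G e"
    "b \<Longrightarrow> t < len G e" "\<not> b \<Longrightarrow> 0 < t" "epos G e t = p"
    using tdirs_cases[OF assms] by metis
  have "(if b then len G e - t else t) > 0" using * by auto
  from eventually_at_right_0_less[OF this] show ?thesis
  proof eventually_elim
    case (elim h)
    show ?case unfolding ray_def *(1) prod.case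
      by (rule epos_in_pts[OF assms(1)]) (use * elim in \<open>auto split: if_splits\<close>)
  qed
qed

lemma pl_int_on_right_germ:
  assumes "pl_int_on a b g" "a \<le> t" "t < b"
  shows "\<exists>m d. 0 < d \<and> (\<forall>h. 0 \<le> h \<and> h \<le> d \<longrightarrow> g (t + h) = g t + of_int m * h)"
proof -
  obtain xs ms where X: "length xs \<ge> 2" "sorted_wrt (<) xs" "hd xs = a" "last xs = b"
    "length ms = length xs - 1"
    and lin: "\<And>i t. i < length ms \<Longrightarrow> t \<in> {xs ! i .. xs ! Suc i} \<Longrightarrow>
          g t = g (xs ! i) + of_int (ms ! i) * (t - xs ! i)"
    using assms(1) unfolding pl_int_on_def by blast
  let ?I = "{i. i < length xs \<and> xs ! i \<le> t}"
  \<comment> \<open>The piece to the right of \<open>t\<close> starts at the last breakpoint not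
    exceeding \<open>t\<close>.\<close>
  define i where "i = Max ?I"
  have fin: "finite ?I" by auto
  have "xs \<noteq> []" using X(1) by auto
  have "0 \<in> ?I" using X(1,3) assms(2) \<open>xs \<noteq> []\<close> by (auto simp: hd_conv_nth)
  then have iI: "i \<in> ?I" unfolding i_def by (intro Max_in fin) auto
  have "i \<noteq> length xs - 1" using iI X(4) assms(3) \<open>xs \<noteq> []\<close> by (auto simp: last_conv_nth)
  with iI have i: "Suc i < length xs" by auto
  have "Suc i \<notin> ?I" using Max_ge[OF fin, of "Suc i"] unfolding i_def[symmetric] by auto
  with i have t: "t < xs ! Suc i" by auto
  have *: "g s = g (xs ! i) + of_int (ms ! i) * (s - xs ! i)" if "t \<le> s" "s \<le> xs ! Suc i" for s
    by (rule lin) (use that iI i X in auto)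
  have "g (t + h) = g t + of_int (ms ! i) * h" if "0 \<le> h" "h \<le> xs ! Suc i - t" for h
    using *[of t] *[of "t + h"] that t by (auto simp: algebra_simps)
  with t show ?thesis by (intro exI[of _ "ms ! i"] exI[of _ "xs ! Suc i - t"]) auto
qed

text \<open>Two changes against the right germ: at a breakpoint the piece ending there is needed,
  hence the strict \<open>xs ! i < t\<close>, and the slope changes sign because \<open>h\<close>
  runs backwards.\<close>

lemma pl_int_on_left_germ:
  assumes "pl_int_on a b g" "a < t" "t \<le> b"
  shows "\<exists>m d. 0 < d \<and> (\<forall>h. 0 \<le> h \<and> h \<le> d \<longrightarrow> g (t - h) = g t + of_int m * h)"
proof -
  obtain xs ms where X: "length xs \<ge> 2" "sorted_wrt (<) xs" "hd xs = a" "last xs = b"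
    "length ms = length xs - 1"
    and lin: "\<And>i t. i < length ms \<Longrightarrow> t \<in> {xs ! i .. xs ! Suc i} \<Longrightarrow>
          g t = g (xs ! i) + of_int (ms ! i) * (t - xs ! i)"
    using assms(1) unfolding pl_int_on_def by blast
  let ?I = "{i. i < length xs \<and> xs ! i < t}"
  define i where "i = Max ?I"
  have fin: "finite ?I" by auto
  have "xs \<noteq> []" using X(1) by auto
  have "0 \<in> ?I" using X(1,3) assms(2) \<open>xs \<noteq> []\<close> by (auto simp: hd_conv_nth)
  then have iI: "i \<in> ?I" unfolding i_def by (intro Max_in fin) auto
  have "i \<noteq> length xs - 1" using iI X(4) assms(3) \<open>xs \<noteq> []\<close> by (auto simp: last_conv_nth)
  with iI have i: "Suc i < length xs" by auto
  have "Suc i \<notin> ?I" using Max_ge[OF fin, of "Suc i"] unfolding i_def[symmetric] by auto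
  with i have t: "t \<le> xs ! Suc i" by auto
  have *: "g s = g (xs ! i) + of_int (ms ! i) * (s - xs ! i)" if "xs ! i \<le> s" "s \<le> t" for s
    by (rule lin) (use that iI i X t in auto)
  have "g (t - h) = g t + of_int (- (ms ! i)) * h" if "0 \<le> h" "h \<le> t - xs ! i" for h
    using *[of t] *[of "t - h"] that iI by (auto simp: algebra_simps)
  with iI show ?thesis by (intro exI[of _ "- (ms ! i)"] exI[of _ "t - xs ! i"]) auto
qed

text \<open>Turns the limit in \<open>sl\<close> into an exact affine formula near \<open>p\<close>,
  the form in which slopes are compared from here on.\<close>

lemma eventually_germ:
  assumes "metric_graph G" "p \<in> pts G" "\<eta> \<in> tdirs G p" "pl_fun G f"
  shows "eventually (\<lambda>h. f (ray G \<eta> h) = f p + sl G f \<eta> * h) (at_right 0)"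
proof -
  obtain e t b where *: "\<eta> = (e, t, b)" "e \<in> edges G" "0 \<le> t" "t \<le> len G e"
    "b \<Longrightarrow> t < len G e" "\<not> b \<Longrightarrow> 0 < t" "epos G e t = p"
    using tdirs_cases[OF assms(1-3)] by metis
  have pl: "pl_int_on 0 (len G e) (\<lambda>t. f (epos G e t))"
    using assms(4) *(2) by (auto simp: pl_fun_def)
  have "\<exists>m d. 0 < d \<and> (\<forall>h. 0 \<le> h \<and> h \<le> d \<longrightarrow> f (ray G \<eta> h) = f p + of_int m * h)"
  proof (cases b)
    case True
    with pl_int_on_right_germ[OF pl, of t] * show ?thesis by (auto simp: ray_def)
  next
    case False
    with pl_int_on_left_germ[OF pl, of t] * show ?thesis by (auto simp: ray_def)
  qed
  then obtain m d where d: "0 < d"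
    and lin: "\<And>h. 0 \<le> h \<Longrightarrow> h \<le> d \<Longrightarrow> f (ray G \<eta> h) = f p + of_int m * h" by blast
  have ev: "eventually (\<lambda>h. f (ray G \<eta> h) = f p + of_int m * h) (at_right 0)"
    using eventually_at_right_0_less[OF d] by eventually_elim (auto intro: lin)
  then have "sl G f \<eta> = of_int m" by (intro sl_eqI) (simp add: ray_0[OF assms(1-3)])
  with ev show ?thesis by simp
qed

section \<open>Tropical dependence at a point\<close>

lemma eventually_affine_less:
  assumes "a < (b::real)"
  shows "eventually (\<lambda>h. a + m * h < b + n * h) (at_right 0)"
proof -
  have "((\<lambda>h. (b + n * h) - (a + m * h)) \<longlongrightarrow> (b + n * 0) - (a + m * 0)) (at_right 0)"
    by (intro tendsto_intros)
  from order_tendstoD(1)[OF this, of 0] assms show ?thesis by (auto elim: eventually_mono)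
qed

text \<open>The minimisers at \<open>p\<close> are the only functions that can be minimal near \<open>p\<close>.\<close>
lemma tdep_local:
  assumes G: "metric_graph G" and p: "p \<in> pts G"
    and F: "finite F" "\<And>g. g \<in> F \<Longrightarrow> pl_fun G g" and dep: "tdep G F"
  obtains F0 where "F0 \<subseteq> F"
    "\<And>\<eta>. \<eta> \<in> tdirs G p \<Longrightarrow> \<exists>g1\<in>F0. \<exists>g2\<in>F0. g1 \<noteq> g2 \<and> sl G g1 \<eta> = sl G g2 \<eta> \<and>
       (\<forall>g\<in>F0. sl G g1 \<eta> \<le> sl G g \<eta>)"
proof -
  obtain a where a: "\<And>q. q \<in> pts G \<Longrightarrow> \<exists>g1\<in>F. \<exists>g2\<in>F. g1 \<noteq> g2 \<and>
       g1 q + a g1 = Min ((\<lambda>g. g q + a g) ` F) \<and> g2 q + a g2 = Min ((\<lambda>g. g q + a g) ` F)"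
    using dep unfolding tdep_def by blast
  \<comment> \<open>\<open>F0\<close> depends on the values at \<open>p\<close> alone, so one set
    serves every direction; \<open>superlevel_eq_if_all_slopes\<close> plays two directions against
    each other.\<close>
  define F0 where "F0 = {g\<in>F. \<forall>g'\<in>F. g p + a g \<le> g' p + a g'}"
  obtain g0 where g0: "g0 \<in> F" "g0 p + a g0 = Min ((\<lambda>g. g p + a g) ` F)" using a[OF p] by blast
  then have g0F: "g0 \<in> F0" using F(1) by (auto simp: F0_def)
  have "\<exists>g1\<in>F0. \<exists>g2\<in>F0. g1 \<noteq> g2 \<and> sl G g1 \<eta> = sl G g2 \<eta> \<and> (\<forall>g\<in>F0. sl G g1 \<eta> \<le> sl G g \<eta>)"
    if \<eta>: "\<eta> \<in> tdirs G p" for \<eta>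
  proof -
    have e1: "eventually (\<lambda>h. \<forall>g\<in>F. g (ray G \<eta> h) = g p + sl G g \<eta> * h) (at_right 0)"
      by (intro eventually_ball_finite F(1)) (auto intro: eventually_germ G p \<eta> F(2))
    \<comment> \<open>Outside \<open>F0\<close> there is a positive gap to \<open>g0\<close> at
      \<open>p\<close>, which finitely many slopes cannot close for small \<open>h\<close>.\<close>
    have e2: "eventually (\<lambda>h. \<forall>g\<in>F - F0. (g0 p + a g0) + sl G g0 \<eta> * h < (g p + a g) + sl G g \<eta> * h)
        (at_right 0)"
    proof (intro eventually_ball_finite ballI eventually_affine_less)
      fix g assume g: "g \<in> F - F0"
      then obtain g' where "g' \<in> F" "g' p + a g' < g p + a g" by (auto simp: F0_def not_le)
      with g0F show "g0 p + a g0 < g p + a g" by (force simp: F0_def)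
    qed (use F in auto)
    have "eventually (\<lambda>h. 0 < h \<and> ray G \<eta> h \<in> pts G \<and> (\<forall>g\<in>F. g (ray G \<eta> h) = g p + sl G g \<eta> * h) \<and>
       (\<forall>g\<in>F - F0. (g0 p + a g0) + sl G g0 \<eta> * h < (g p + a g) + sl G g \<eta> * h)) (at_right 0)"
      using e1 e2 eventually_ray_in_pts[OF G p \<eta>] eventually_at_right_less[of 0]
      by eventually_elim auto
    from eventually_happens'[OF _ this] obtain h where h: "0 < h" "ray G \<eta> h \<in> pts G"
      and lin: "\<And>g. g \<in> F \<Longrightarrow> g (ray G \<eta> h) = g p + sl G g \<eta> * h"
      and big: "\<And>g. g \<in> F - F0 \<Longrightarrow> (g0 p + a g0) + sl G g0 \<eta> * h < (g p + a g) + sl G g \<eta> * h"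
      by (auto simp: trivial_limit_at_right_real)
    obtain g1 g2 where g: "g1 \<in> F" "g2 \<in> F" "g1 \<noteq> g2"
      "g1 (ray G \<eta> h) + a g1 = Min ((\<lambda>g. g (ray G \<eta> h) + a g) ` F)"
      "g2 (ray G \<eta> h) + a g2 = Min ((\<lambda>g. g (ray G \<eta> h) + a g) ` F)"
      using a[OF h(2)] by blast
    have m1: "g1 p + a g1 + sl G g1 \<eta> * h \<le> g p + a g + sl G g \<eta> * h" if "g \<in> F" for g
      using g(4) lin[OF g(1)] lin[OF that] F(1) that
      by (smt (verit, best) Min_le finite_imageI image_eqI)
    have m2: "g2 p + a g2 + sl G g2 \<eta> * h \<le> g p + a g + sl G g \<eta> * h" if "g \<in> F" for g
      using g(5) lin[OF g(2)] lin[OF that] F(1) that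
      by (smt (verit, best) Min_le finite_imageI image_eqI)
    have in0: "g1 \<in> F0" "g2 \<in> F0"
      using big[of g1] big[of g2] m1[OF g0(1)] m2[OF g0(1)] g(1,2) by force+
    \<comment> \<open>All of \<open>F0\<close> ties at \<open>p\<close>, so comparing values at
      distance \<open>h\<close> amounts to comparing slopes.\<close>
    have same: "g p + a g = g0 p + a g0" if "g \<in> F0" for g
      using that g0F by (force simp: F0_def)
    have "sl G g1 \<eta> * h \<le> sl G g \<eta> * h" "sl G g2 \<eta> * h \<le> sl G g \<eta> * h" if "g \<in> F0" for g
      using m1[of g] m2[of g] same[OF that] same[OF in0(1)] same[OF in0(2)] that
      by (auto simp: F0_def)
    with h(1) have "sl G g1 \<eta> \<le> sl G g \<eta>" "sl G g2 \<eta> \<le> sl G g \<eta>" if "g \<in> F0" for g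
      using that by auto
    with in0 g(3) show ?thesis by (meson antisym)
  qed
  moreover have "F0 \<subseteq> F" by (auto simp: F0_def)
  ultimately show ?thesis using that by blast
qed

section \<open>Slope sets\<close>

lemma tls_pl_fun: "tls G r D S \<Longrightarrow> g \<in> S \<Longrightarrow> pl_fun G g"
  by (auto simp: tls_def RR_def)

text \<open>Dependence would give two distinct functions sharing a slope along
  \<open>\<eta>\<close>.\<close>

lemma not_tdep_if_inj_slopes:
  assumes "metric_graph G" "p \<in> pts G" "\<eta> \<in> tdirs G p" "finite F" "\<And>g. g \<in> F \<Longrightarrow> pl_fun G g"
    and "inj_on (\<lambda>g. sl G g \<eta>) F"
  shows "\<not> tdep G F"
proof
  assume "tdep G F"
  from tdep_local[OF assms(1,2,4,5) this] obtain F0 where "F0 \<subseteq> F"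
    "\<And>\<eta>. \<eta> \<in> tdirs G p \<Longrightarrow> \<exists>g1\<in>F0. \<exists>g2\<in>F0. g1 \<noteq> g2 \<and> sl G g1 \<eta> = sl G g2 \<eta> \<and>
       (\<forall>g\<in>F0. sl G g1 \<eta> \<le> sl G g \<eta>)" by metis
  then obtain g1 g2 where "g1 \<in> F" "g2 \<in> F" "g1 \<noteq> g2" "sl G g1 \<eta> = sl G g2 \<eta>"
    using assms(3) by (meson subsetD)
  with assms(6) show False by (auto dest: inj_onD)
qed

text \<open>Representatives of \<open>r + 2\<close> distinct slopes would be dependent by the
  definition of \<open>tls\<close>, yet functions with distinct slopes in one direction never
  are.\<close>

lemma slset_le:
  assumes G: "metric_graph G" "p \<in> pts G" "\<eta> \<in> tdirs G p" and S: "tls G r D S"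
  shows "finite (slset G S \<eta>) \<and> card (slset G S \<eta>) \<le> r + 1"
proof (rule ccontr)
  assume *: "\<not> ?thesis"
  have "\<exists>B. B \<subseteq> slset G S \<eta> \<and> finite B \<and> card B = r + 2"
  proof (cases "finite (slset G S \<eta>)")
    case True
    with * have "r + 2 \<le> card (slset G S \<eta>)" by auto
    then show ?thesis by (metis obtain_subset_with_card_n)
  next
    case False
    then show ?thesis by (metis infinite_arbitrarily_large)
  qed
  then obtain B where B: "B \<subseteq> (\<lambda>g. sl G g \<eta>) ` S" "finite B" "card B = r + 2"
    by (auto simp: slset_def)
  then obtain F where F: "F \<subseteq> S" "inj_on (\<lambda>g. sl G g \<eta>) F" "B = (\<lambda>g. sl G g \<eta>) ` F"
    using subset_image_inj[of B] by metis
  then have "finite F" "card F = r + 2" using B by (auto simp: card_image dest: finite_imageD)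
  then have "tdep G F" using S F(1) by (auto simp: tls_def)
  with not_tdep_if_inj_slopes[OF G \<open>finite F\<close> _ F(2)] F(1) tls_pl_fun[OF S] show False by blast
qed

text \<open>Requiring a zero at \<open>r\<close> points of the interval yields a minimum of affine functions with
  \<open>r\<close> breakpoints, which is concave and hence takes \<open>r + 1\<close> slopes.\<close>
lemma affine_generators_slopes:
  fixes G :: "('v, 'e) mgraph"
  assumes G: "metric_graph G" "e \<in> edges G"
    and S: "tls G r D (tspan G Gs)" "finite Gs"
    and I: "lo < hi" "\<And>u. lo < u \<Longrightarrow> u < hi \<Longrightarrow> 0 < u \<and> u < len G e"
    and D0: "\<And>u. lo < u \<Longrightarrow> u < hi \<Longrightarrow> D (Inn e u) = 0"
    and lin: "\<And>g u. g \<in> Gs \<Longrightarrow> lo < u \<Longrightarrow> u < hi \<Longrightarrow> g (Inn e u) = c g + m g * u"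
  shows "r + 1 \<le> card (m ` Gs)"
proof -
  \<comment> \<open>For \<open>i < r\<close> these points sit at the fractions
    \<open>1/(r+1), ..., r/(r+1)\<close>, strictly inside the interval.\<close>
  define x where "x i = lo + (hi - lo) * ((real i + 1) / (real r + 1))" for i
  have x_mono: "x i < x j" if "i < j" for i j
    using that I(1) unfolding x_def by (simp add: divide_strict_right_mono)
  have x_gt: "lo < x i" for i using I(1) by (auto simp: x_def)
  have x_lt: "x i < hi" if "i < r" for i
  proof -
    have "(real i + 1) / (real r + 1) < 1" using that by auto
    then have "(hi - lo) * ((real i + 1) / (real r + 1)) < (hi - lo) * 1"
      using I(1) by (intro mult_strict_left_mono) auto
    then show ?thesis by (simp add: x_def)
  qed
  have inj: "inj_on (\<lambda>i. Inn e (x i) :: ('v, 'e) gpt) {..<r}"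
    by (rule inj_onI) (metis gpt.inject(2) less_irrefl linorder_neqE_nat x_mono)
  define Z :: "('v, 'e) gpt set" where "Z = (\<lambda>i. Inn e (x i)) ` {..<r}"
  define E where "E q = (if q \<in> Z then 1 else 0 :: int)" for q
  have supp: "{q. E q \<noteq> 0} = Z" by (auto simp: E_def)
  have "Z \<subseteq> pts G" using I(2)[OF x_gt x_lt] G(2) by (auto simp: Z_def pts_def)
  then have "effective G E"
    unfolding effective_def is_divisor_def supp by (auto simp: Z_def E_def)
  moreover have "deg E = int r"
  proof -
    have "deg E = (\<Sum>q\<in>Z. 1)" unfolding deg_def supp by (intro sum.cong) (auto simp: E_def)
    then show ?thesis using card_image[OF inj] by (simp add: Z_def)
  qed
  ultimately obtain f where f: "f \<in> tspan G Gs" "div_ge G D f E"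
    using S(1) unfolding tls_def by blast
  then obtain H a where H: "H \<subseteq> Gs" "finite H" "H \<noteq> {}"
    and f_eq: "f = (\<lambda>p. if p \<in> pts G then Min ((\<lambda>g. g p + a g) ` H) else 0)"
    by (auto simp: tspan_def)
  define b where "b g = c g + a g" for g
  have f_Inn: "f (Inn e u) = Min ((\<lambda>g. b g + m g * u) ` H)" if u: "lo < u" "u < hi" for u
  proof -
    have "Inn e u \<in> pts G" using I(2)[OF u] G(2) by (auto simp: pts_def)
    then have "f (Inn e u) = Min ((\<lambda>g. g (Inn e u) + a g) ` H)" by (simp add: f_eq)
    also have "(\<lambda>g. g (Inn e u) + a g) ` H = (\<lambda>g. b g + m g * u) ` H"
      by (intro image_cong refl) (use lin[OF _ u] H(1) in \<open>auto simp: b_def\<close>)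
    finally show ?thesis .
  qed
  \<comment> \<open>The lines of the lower envelope that are active at \<open>u\<close>. Concavity
    of the envelope is \<open>act_mono\<close>: active slopes do not increase from left to
    right.\<close>
  define act where "act u = {g\<in>H. \<forall>g'\<in>H. b g + m g * u \<le> b g' + m g' * u}" for u
  have act_ne: "\<exists>g. g \<in> act u" for u
  proof -
    have "Min ((\<lambda>g. b g + m g * u) ` H) \<in> (\<lambda>g. b g + m g * u) ` H" using H by (intro Min_in) auto
    then obtain g where "g \<in> H" "b g + m g * u = Min ((\<lambda>g. b g + m g * u) ` H)" by auto
    with H show ?thesis by (auto simp: act_def)
  qed
  have f_act: "f (Inn e u) = b g + m g * u" if "lo < u" "u < hi" "g \<in> act u" for u g
    unfolding f_Inn[OF that(1,2)] using that(3) H(2) by (intro Min_eqI) (auto simp: act_def)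
  have act_mono: "m g' \<le> m g" if "g \<in> act u" "g' \<in> act v" "u < v" for g g' u v
  proof -
    have "b g + m g * u \<le> b g' + m g' * u" "b g' + m g' * v \<le> b g + m g * v"
      using that by (auto simp: act_def)
    then have "(m g' - m g) * (v - u) \<le> 0" by (simp add: algebra_simps)
    with \<open>u < v\<close> show ?thesis by (simp add: mult_le_0_iff)
  qed
  \<comment> \<open>If all active slopes agreed, \<open>f\<close> would be affine around
    \<open>x i\<close>; as \<open>D\<close> is zero there, \<open>D + div(f)\<close> would vanish
    where \<open>E\<close> demands 1.\<close>
  have "\<exists>g\<in>act (x i). \<exists>g'\<in>act (x i). m g < m g'" if i: "i < r" for i
  proof (rule ccontr)
    assume "\<not> ?thesis"
    then have same: "m g = m g'" if "g \<in> act (x i)" "g' \<in> act (x i)" for g g'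
      using that by (meson linorder_neqE)
    obtain g where g: "g \<in> act (x i)" using act_ne by blast
    note xi = x_gt[of i] x_lt[OF i]
    have germ: "eventually (\<lambda>h. f (Inn e (x i + s * h)) = f (Inn e (x i)) + (s * m g) * h) (at_right 0)"
      if s: "s = 1 \<or> s = -1" for s
    proof -
      have "eventually (\<lambda>h. \<forall>g'\<in>H. b g' + m g' * x i + (s * m g') * h \<ge> b g + m g * x i + (s * m g) * h)
          (at_right 0)"
      proof (intro eventually_ball_finite ballI H(2))
        fix g' assume g': "g' \<in> H"
        show "eventually (\<lambda>h. b g' + m g' * x i + (s * m g') * h \<ge> b g + m g * x i + (s * m g) * h)
          (at_right 0)"
        proof (cases "g' \<in> act (x i)")
          case True
          then have "b g' + m g' * x i = b g + m g * x i"
            using g f_act[OF xi] by metis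
          then show ?thesis using same[OF True g] by simp
        next
          case False
          then obtain g'' where "g'' \<in> H" "b g'' + m g'' * x i < b g' + m g' * x i"
            using g' by (auto simp: act_def not_le)
          with g have "b g + m g * x i < b g' + m g' * x i" by (force simp: act_def)
          from eventually_affine_less[OF this, of "s * m g" "s * m g'"]
          show ?thesis by eventually_elim auto
        qed
      qed
      moreover have "eventually (\<lambda>h. 0 < h \<and> h < min (x i - lo) (hi - x i)) (at_right 0)"
        by (rule eventually_at_right_0_less) (use xi in auto)
      ultimately show ?thesis
      proof eventually_elim
        case (elim h)
        have "g \<in> act (x i + s * h)"
          using g elim(1) by (auto simp: act_def algebra_simps)
        with elim(2) s have "f (Inn e (x i + s * h)) = b g + m g * (x i + s * h)"
          by (intro f_act) auto
        with f_act[OF xi g] show ?case by (simp add: algebra_simps)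
      qed
    qed
    have rays: "eventually (\<lambda>h. ray G (e, x i, d) h = Inn e (x i + (if d then 1 else -1) * h)) (at_right 0)" for d
    proof -
      have "eventually (\<lambda>h. 0 < h \<and> h < min (x i - lo) (hi - x i)) (at_right 0)"
        by (rule eventually_at_right_0_less) (use xi in auto)
      then show ?thesis
      proof eventually_elim
        case (elim h)
        with I(2)[of "x i + h"] I(2)[of "x i - h"] xi show ?case by (auto simp: ray_def epos_def)
      qed
    qed
    have ray0: "ray G (e, x i, d) 0 = Inn e (x i)" for d
      using I(2)[OF xi] by (auto simp: ray_def epos_def)
    have sl: "sl G f (e, x i, d) = (if d then 1 else -1) * m g" for d
    proof (rule sl_eqI, unfold ray0)
      have "eventually (\<lambda>h. f (Inn e (x i + (if d then 1 else - 1) * h)) =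
          f (Inn e (x i)) + (if d then 1 else - 1) * m g * h) (at_right 0)"
        by (rule germ) auto
      with rays[of d] show "eventually (\<lambda>h. f (ray G (e, x i, d) h) =
          f (Inn e (x i)) + (if d then 1 else - 1) * m g * h) (at_right 0)"
        by eventually_elim simp
    qed
    have "divf G f (Inn e (x i)) = 0" unfolding divf_def by (simp add: sl del: sl.simps)
    moreover have "Inn e (x i) \<in> Z" using i by (auto simp: Z_def)
    moreover from this have "real_of_int (E (Inn e (x i))) \<le>
        real_of_int (D (Inn e (x i))) + divf G f (Inn e (x i))"
      using f(2) \<open>Z \<subseteq> pts G\<close> unfolding div_ge_def by blast
    ultimately show False by (simp add: E_def D0[OF xi])
  qed
  then obtain l k where lk: "\<And>i. i < r \<Longrightarrow> l i \<in> act (x i)" "\<And>i. i < r \<Longrightarrow> k i \<in> act (x i)"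
    "\<And>i. i < r \<Longrightarrow> m (l i) < m (k i)"
    by metis
  \<comment> \<open>For \<open>i < j\<close>, \<open>m (l j) < m (k j) \<le> m (l i)\<close>. This
    yields \<open>r\<close> slopes, and \<open>k 0\<close> at the leftmost point adds a larger
    one.\<close>
  have dec: "m (l j) < m (l i)" if "i < j" "j < r" for i j
    using act_mono[OF lk(1)[of i] lk(2)[of j] x_mono[of i j]] lk(3)[of j] that by auto
  have "inj_on (\<lambda>i. m (l i)) {..<r}"
    by (rule inj_onI) (metis dec lessThan_iff less_irrefl linorder_neqE_nat)
  from card_image[OF this] have card: "card ((\<lambda>i. m (l i)) ` {..<r}) = r" by simp
  show ?thesis
  \<comment> \<open>For \<open>r = 0\<close> there is no constrained point \<open>x 0\<close>; any
    generator supplies the one slope.\<close>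
  proof (cases "r = 0")
    case True
    have "card (m ` Gs) \<noteq> 0" using H S(2) by auto
    then show ?thesis using True by linarith
  next
    case False
    have "m (l i) < m (k 0)" if "i < r" for i
      using dec[of 0 i] lk(3)[of 0] that by (cases i) (auto intro: less_trans)
    then have "m (k 0) \<notin> (\<lambda>i. m (l i)) ` {..<r}" by force
    then have "card (insert (m (k 0)) ((\<lambda>i. m (l i)) ` {..<r})) = r + 1" using card by simp
    moreover have "l i \<in> Gs" "k i \<in> Gs" if "i < r" for i
      using lk(1,2)[OF that] H(1) by (auto simp: act_def)
    then have "insert (m (k 0)) ((\<lambda>i. m (l i)) ` {..<r}) \<subseteq> m ` Gs"
      using False by auto
    ultimately show ?thesis using card_mono[of "m ` Gs"] S(2) by (metis finite_imageI)
  qed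
qed

lemma eventually_ray_notin_finite:
  fixes G :: "('v, 'e) mgraph"
  assumes "metric_graph G" "p \<in> pts G" "\<eta> \<in> tdirs G p" "finite Q"
  shows "eventually (\<lambda>h. ray G \<eta> h \<notin> Q) (at_right 0)"
proof -
  obtain e t b where *: "\<eta> = (e, t, b)" "e \<in> edges G" "0 \<le> t" "t \<le> len G e"
    "b \<Longrightarrow> t < len G e" "\<not> b \<Longrightarrow> 0 < t" "epos G e t = p"
    using tdirs_cases[OF assms(1-3)] by metis
  have "eventually (\<lambda>h. \<forall>q\<in>Q. ray G \<eta> h \<noteq> q) (at_right 0)"
  proof (intro eventually_ball_finite assms(4) ballI)
    fix q :: "('v, 'e) gpt"
    \<comment> \<open>The value 1 is arbitrary: at small positive \<open>h\<close> the ray is at an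
      interior point with parameter other than \<open>t\<close>, so it misses such \<open>q\<close>
      anyway.\<close>
    define d where "d = (case q of Vtx v \<Rightarrow> 1 | Inn e' s \<Rightarrow> if s = t then 1 else \<bar>s - t\<bar>)"
    have "min d (if b then len G e - t else t) > 0" using * by (auto simp: d_def split: gpt.splits)
    from eventually_at_right_0_less[OF this] show "eventually (\<lambda>h. ray G \<eta> h \<noteq> q) (at_right 0)"
    proof eventually_elim
      case (elim h)
      then show ?case using * by (cases q) (auto simp: ray_def epos_def d_def split: if_splits)
    qed
  qed
  then show ?thesis by eventually_elim auto
qed

text \<open>The upper bound is \<open>slset_le\<close>. For the lower bound, a short open interval
  next to \<open>p\<close> avoids the support of \<open>D\<close> and has all generators affine, so
  \<open>affine_generators_slopes\<close> applies there.\<close>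

lemma card_slset:
  assumes G: "metric_graph G" "p \<in> pts G" "\<eta> \<in> tdirs G p" and S: "tls G r D S"
  shows "finite (slset G S \<eta>)" "card (slset G S \<eta>) = r + 1"
proof -
  obtain e t b where *: "\<eta> = (e, t, b)" "e \<in> edges G" "0 \<le> t" "t \<le> len G e"
    "b \<Longrightarrow> t < len G e" "\<not> b \<Longrightarrow> 0 < t" "epos G e t = p"
    using tdirs_cases[OF G] by metis
  obtain Gs where Gs: "finite Gs" "S = tspan G Gs" using S unfolding tls_def by blast
  \<comment> \<open>Generators may be nonzero off the graph, whereas members of \<open>S\<close>
    vanish there; \<open>res\<close> normalises them.\<close>
  define res where "res g = (\<lambda>q. if q \<in> pts G then g q else 0)" for g :: "('a, 'b) gpt \<Rightarrow> real"
  have res_S: "res g \<in> S" if "g \<in> Gs" for g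
  proof -
    have "res g = (\<lambda>q. if q \<in> pts G then Min ((\<lambda>g. g q + 0) ` {g}) else 0)"
      by (auto simp: res_def)
    with that show ?thesis unfolding Gs(2) tspan_def
      by (intro CollectI exI[of _ "{g}"] exI[of _ "\<lambda>_. 0"]) auto
  qed
  define m where "m g = sl G (res g) \<eta>" for g
  have finD: "finite {q. D q \<noteq> 0}" using S by (auto simp: tls_def is_divisor_def)
  have germs: "eventually (\<lambda>h. \<forall>g\<in>Gs. res g (ray G \<eta> h) = res g p + m g * h) (at_right 0)"
    unfolding m_def
    by (intro eventually_ball_finite Gs(1) ballI eventually_germ G tls_pl_fun[OF S] res_S)
  have "(if b then len G e - t else t) > 0" using * by auto
  note less = eventually_at_right_0_less[OF this]
  have "eventually (\<lambda>h. h < (if b then len G e - t else t) \<and> D (ray G \<eta> h) = 0 \<and>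
      (\<forall>g\<in>Gs. g (ray G \<eta> h) = g p + m g * h)) (at_right 0)"
    using germs eventually_ray_notin_finite[OF G finD] less
      eventually_ray_in_pts[OF G]
    by (eventually_elim) (use G(2) in \<open>auto simp: res_def\<close>)
  then obtain d where d: "d > 0" and near: "\<And>h. 0 < h \<Longrightarrow> h < d \<Longrightarrow>
      h < (if b then len G e - t else t) \<and> D (ray G \<eta> h) = 0 \<and>
      (\<forall>g\<in>Gs. g (ray G \<eta> h) = g p + m g * h)"
    unfolding eventually_at_right_field by auto
  \<comment> \<open>Orientation of the ray against the edge parameter: \<open>u = t + s * h\<close>,
    so slopes in \<open>u\<close> are \<open>s\<close> times outgoing slopes. Scaling by
    \<open>s\<close> cannot raise their number.\<close>
  define s :: real where "s = (if b then 1 else -1)"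
  have at: "0 < u \<and> u < len G e \<and> ray G \<eta> (s * (u - t)) = Inn e u"
    "0 < s * (u - t)" "s * (u - t) < d"
    if "(if b then t else t - d) < u" "u < (if b then t + d else t)" for u
    using that near[of "s * (u - t)"] * by (auto simp: s_def ray_def epos_def split: if_splits)
  have "r + 1 \<le> card ((\<lambda>g. s * m g) ` Gs)"
  proof (rule affine_generators_slopes[OF G(1) *(2) S[unfolded Gs(2)] Gs(1),
        where lo = "if b then t else t - d" and hi = "if b then t + d else t"
          and c = "\<lambda>g. g p - s * m g * t"])
    fix u assume u: "(if b then t else t - d) < u" "u < (if b then t + d else t)"
    show "0 < u \<and> u < len G e" "D (Inn e u) = 0" using at[OF u] near[OF at(2,3)[OF u]] by auto
    fix g assume "g \<in> Gs"
    then show "g (Inn e u) = g p - s * m g * t + s * m g * u"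
      using at[OF u] near[OF at(2,3)[OF u]] by (auto simp: algebra_simps)
  qed (use d in auto)
  also have "(\<lambda>g. s * m g) ` Gs = (\<lambda>y. s * y) ` m ` Gs" by auto
  also have "card \<dots> \<le> card (m ` Gs)" by (intro card_image_le finite_imageI Gs(1))
  also have "m ` Gs \<subseteq> slset G S \<eta>" using res_S by (auto simp: slset_def m_def)
  with slset_le[OF G S] have "card (m ` Gs) \<le> card (slset G S \<eta>)" by (intro card_mono) auto
  finally show "card (slset G S \<eta>) = r + 1" "finite (slset G S \<eta>)"
    using slset_le[OF G S] by auto
qed

section \<open>Permutation arrays from min-closed arrays\<close>

lemma arr_antisym:
  assumes "x \<in> arr r T" "y \<in> arr r T" "cle T x y" "cle T y x"
  shows "x = y"
proof
  fix i show "x i = y i"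
    using assms by (cases "i \<in> T") (auto simp: arr_def cle_def intro: antisym)
qed

text \<open>One witness per coordinate suffices: together the witnesses form \<open>Q\<close>. They
  cannot all be one point, since that point would agree with \<open>y\<close> on \<open>T\<close>,
  and both vanish outside \<open>T\<close>.\<close>

lemma redundant_iff:
  assumes "finite T" "T \<noteq> {}" "A \<subseteq> arr r T"
  shows "redundant r T A y \<longleftrightarrow> y \<in> arr r T \<and> (\<forall>i\<in>T. \<exists>q\<in>A. q \<noteq> y \<and> cle T y q \<and> q i = y i)"
proof
  assume "redundant r T A y"
  then obtain Q where Q: "y \<in> arr r T" "Q \<subseteq> A" "finite Q" "card Q \<ge> 2" "y \<notin> Q"
    "\<And>i. i \<in> T \<Longrightarrow> y i = Min ((\<lambda>q. q i) ` Q)" unfolding redundant_def by blast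
  have "cle T y q" if "q \<in> Q" for q
    using that Q(3,6) by (auto simp: cle_def)
  moreover have "\<exists>q\<in>Q. q i = y i" if "i \<in> T" for i
  proof -
    have "Min ((\<lambda>q. q i) ` Q) \<in> (\<lambda>q. q i) ` Q" using Q(3,4) by (intro Min_in) auto
    then show ?thesis using Q(6)[OF that] by auto
  qed
  ultimately show "y \<in> arr r T \<and> (\<forall>i\<in>T. \<exists>q\<in>A. q \<noteq> y \<and> cle T y q \<and> q i = y i)"
    using Q(1,2,5) by (metis subsetD)
next
  assume R: "y \<in> arr r T \<and> (\<forall>i\<in>T. \<exists>q\<in>A. q \<noteq> y \<and> cle T y q \<and> q i = y i)"
  then obtain q where q: "\<And>i. i \<in> T \<Longrightarrow> q i \<in> A \<and> q i \<noteq> y \<and> cle T y (q i) \<and> q i i = y i"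
    by metis
  obtain i0 where i0: "i0 \<in> T" using assms(2) by blast
  have "card (q ` T) \<noteq> 0" using assms(1,2) by auto
  moreover have "card (q ` T) \<noteq> 1"
  proof
    assume "card (q ` T) = 1"
    then obtain z where "q ` T = {z}" by (auto simp: card_1_singleton_iff)
    then have z: "q i = z" if "i \<in> T" for i using that by blast
    have "z = y"
    proof
      fix i show "z i = y i"
      proof (cases "i \<in> T")
        case True
        then show ?thesis using q[OF True] z by auto
      next
        case False
        moreover have "z \<in> arr r T" using q[OF i0] z[OF i0] assms(3) by blast
        ultimately show ?thesis using R by (auto simp: arr_def)
      qed
    qed
    with q[OF i0] z[OF i0] show False by auto
  qed
  ultimately have "card (q ` T) \<ge> 2" by linarith
  moreover have "y i = Min ((\<lambda>q. q i) ` q ` T)" if "i \<in> T" for i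
    by (intro Min_eqI[symmetric]) (use assms(1) q that in \<open>force simp: cle_def image_iff\<close>)+
  ultimately show "redundant r T A y" unfolding redundant_def
    using R q assms(1) by (intro conjI exI[of _ "q ` T"]) auto
qed

text \<open>Every coordinate of a redundant point is attained by an element of \<open>P\<close>
  above it, so passing to the closure leaves all ranks unchanged.\<close>

lemma coords_upset_pclosure:
  assumes "finite T" "T \<noteq> {}" "P \<subseteq> arr r T" "i \<in> T"
  shows "(\<lambda>y. y i) ` upset T (pclosure r T P) x = (\<lambda>y. y i) ` upset T P x"
proof
  show "(\<lambda>y. y i) ` upset T P x \<subseteq> (\<lambda>y. y i) ` upset T (pclosure r T P) x"
    by (auto simp: upset_def pclosure_def)
  show "(\<lambda>y. y i) ` upset T (pclosure r T P) x \<subseteq> (\<lambda>y. y i) ` upset T P x"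
  proof
    fix s assume "s \<in> (\<lambda>y. y i) ` upset T (pclosure r T P) x"
    then obtain y where y: "y \<in> P \<or> redundant r T P y" "cle T x y" "s = y i"
      by (auto simp: upset_def pclosure_def)
    then obtain q where q: "q \<in> P" "cle T y q" "q i = y i"
      using redundant_iff[OF assms(1-3)] assms(4) by (auto simp: cle_def)
    have "cle T x q" using y(2) q(2) unfolding cle_def by (meson order_trans)
    with q y(3) show "s \<in> (\<lambda>y. y i) ` upset T P x"
      by (auto simp: upset_def intro!: image_eqI[of _ _ q])
  qed
qed

text \<open>A witness that is itself redundant can be replaced by an element of \<open>P\<close>
  above it with the same coordinate. This is what makes \<open>P\<close> recoverable from its
  closure.\<close>

lemma redundant_pclosure:
  assumes "finite T" "T \<noteq> {}" "P \<subseteq> arr r T"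
  shows "redundant r T (pclosure r T P) y \<longleftrightarrow> redundant r T P y"
proof -
  have cl: "pclosure r T P \<subseteq> arr r T" using assms(3) by (auto simp: pclosure_def redundant_def)
  have "\<exists>q\<in>P. q \<noteq> y \<and> cle T y q \<and> q i = y i"
    if y: "y \<in> arr r T" and i: "i \<in> T" and q: "q \<in> pclosure r T P" "q \<noteq> y" "cle T y q" "q i = y i" for i q
  proof (cases "q \<in> P")
    case False
    then have "redundant r T P q" using q(1) by (auto simp: pclosure_def)
    then obtain q' where q': "q' \<in> P" "cle T q q'" "q' i = q i" "q \<in> arr r T"
      using redundant_iff[OF assms] i by blast
    have "q' \<noteq> y"
    proof
      assume "q' = y"
      have "q = y" using q(3) q'(2,4) y \<open>q' = y\<close> by (auto intro: arr_antisym)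
      with q(2) show False by simp
    qed
    with q' q(3,4) show ?thesis unfolding cle_def by (metis order_trans)
  qed (use q in auto)
  moreover have "P \<subseteq> pclosure r T P" by (auto simp: pclosure_def)
  ultimately show ?thesis unfolding redundant_iff[OF assms] redundant_iff[OF assms(1,2) cl] by blast
qed

text \<open>The only candidate is the set of nonredundant points of \<open>M\<close>. Closure under
  minima keeps the redundant points of \<open>P\<close> inside \<open>M\<close>; conversely, every
  point of \<open>M\<close> lies below points of \<open>P\<close> that share any prescribed
  coordinate, so the discarded points are redundant for \<open>P\<close> as well.\<close>

lemma ex1_perm_array:
  assumes T: "finite T" "T \<noteq> {}" and M: "M \<subseteq> arr r T" "totally_rankable r T M" "rankable T M (int r)"
    and closed: "\<And>x y. x \<in> M \<Longrightarrow> y \<in> M \<Longrightarrow> (\<lambda>i. min (x i) (y i)) \<in> M"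
  shows "\<exists>!P. perm_array r T P \<and> M = pclosure r T P"
proof -
  note red = redundant_iff[OF T]
  define P where "P = {y\<in>M. \<not> redundant r T M y}"
  have PM: "P \<subseteq> M" and Parr: "P \<subseteq> arr r T" using M(1) by (auto simp: P_def)
  have red_mono: "redundant r T M y" if "redundant r T P y" for y
    using that PM unfolding red[OF Parr] red[OF M(1)] by blast
  have closed': "(\<lambda>i. Min ((\<lambda>q. q i) ` Q)) \<in> M" if "finite Q" "Q \<noteq> {}" "Q \<subseteq> M" for Q
    using that
  proof (induction Q rule: finite_ne_induct)
    case (insert q Q)
    then have "(\<lambda>i. min (q i) (Min ((\<lambda>q. q i) ` Q))) \<in> M" by (intro closed) auto
    with insert show ?case by simp
  qed auto
  have in_M: "y \<in> M" if y: "redundant r T P y" for y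
  proof -
    obtain Q where Q: "y \<in> arr r T" "Q \<subseteq> P" "finite Q" "card Q \<ge> 2"
      "\<And>i. i \<in> T \<Longrightarrow> y i = Min ((\<lambda>q. q i) ` Q)" using y unfolding redundant_def by blast
    have "Q \<noteq> {}" using Q(4) by auto
    have "(\<lambda>i. Min ((\<lambda>q. q i) ` Q)) \<in> M" using Q PM \<open>Q \<noteq> {}\<close> by (intro closed') auto
    moreover have "y = (\<lambda>i. Min ((\<lambda>q. q i) ` Q))"
    proof
      fix i show "y i = Min ((\<lambda>q. q i) ` Q)"
      proof (cases "i \<in> T")
        case False
        have "(\<lambda>q. q i) ` Q = {0}" using False Q(2) Parr \<open>Q \<noteq> {}\<close> by (force simp: arr_def)
        then show ?thesis using False Q(1) by (simp add: arr_def)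
      qed (use Q in auto)
    qed
    ultimately show ?thesis by simp
  qed
  have above: "\<exists>q\<in>P. cle T y q \<and> q i = y i" if y: "y \<in> M" and i: "i \<in> T" for y i
  proof -
    \<comment> \<open>A point of maximal coordinate sum in \<open>?C\<close> is not redundant: a
      witness for coordinate \<open>i\<close> would lie strictly above it and still satisfy
      \<open>?C\<close>.\<close>
    let ?C = "\<lambda>q. q \<in> M \<and> cle T y q \<and> q i = y i"
    have "\<forall>q. ?C q \<longrightarrow> sum q T \<le> r * card T"
    proof (intro allI impI)
      fix q assume "?C q"
      then have "sum q T \<le> (\<Sum>i\<in>T. r)" using M(1) by (intro sum_mono) (auto simp: arr_def)
      then show "sum q T \<le> r * card T" by (simp add: mult.commute)
    qed
    then have "\<exists>q. ?C q \<and> (\<forall>q'. ?C q' \<longrightarrow> sum q' T \<le> sum q T)"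
      using ex_has_greatest_nat[of ?C y "\<lambda>q. sum q T" "Suc (r * card T)"] y
      by (auto simp: cle_def le_imp_less_Suc)
    then obtain q where q: "?C q" and qmax: "\<And>q'. ?C q' \<Longrightarrow> sum q' T \<le> sum q T" by blast
    have "\<not> redundant r T M q"
    proof
      assume "redundant r T M q"
      then obtain q' where q': "q' \<in> M" "q' \<noteq> q" "cle T q q'" "q' i = q i"
        unfolding red[OF M(1)] using i by blast
      have "?C q'" using q q' by (force simp: cle_def)
      have "\<exists>j\<in>T. q j < q' j"
      proof (rule ccontr)
        assume "\<not> ?thesis"
        then have "cle T q' q" by (auto simp: cle_def not_less)
        then have "q' = q" using q'(1,3) q M(1) by (blast intro: arr_antisym)
        with q'(2) show False by simp
      qed
      then have "sum q T < sum q' T" using T(1) q'(3)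
        by (intro sum_strict_mono_ex1) (auto simp: cle_def)
      with qmax[OF \<open>?C q'\<close>] show False by simp
    qed
    with q show ?thesis by (auto simp: P_def)
  qed
  \<comment> \<open>Each witness in \<open>M\<close> is pushed up into \<open>P\<close> by
    \<open>above\<close> without changing coordinate \<open>i\<close>.\<close>
  have red_P: "redundant r T P y" if y: "redundant r T M y" for y
    unfolding red[OF Parr]
  proof (intro conjI ballI)
    show yarr: "y \<in> arr r T" using y by (simp add: redundant_def)
    fix i assume i: "i \<in> T"
    then obtain q where q: "q \<in> M" "q \<noteq> y" "cle T y q" "q i = y i"
      using y unfolding red[OF M(1)] by blast
    obtain q' where q': "q' \<in> P" "cle T q q'" "q' i = q i" using above[OF q(1) i] by blast
    have "q' \<noteq> y"
    proof
      assume "q' = y"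
      then have "q = y" using q(1,3) q'(2) yarr M(1) by (blast intro: arr_antisym)
      with q(2) show False by simp
    qed
    with q q' show "\<exists>q\<in>P. q \<noteq> y \<and> cle T y q \<and> q i = y i"
      unfolding cle_def by (metis order_trans)
  qed
  have MP: "M = pclosure r T P"
    using PM in_M red_P by (auto simp: pclosure_def P_def)
  have coords: "(\<lambda>y. y i) ` upset T M x = (\<lambda>y. y i) ` upset T P x" if "i \<in> T" for i x
    unfolding MP by (rule coords_upset_pclosure[OF T Parr that])
  have "perm_array r T P" unfolding perm_array_def
  proof (intro conjI ballI Parr)
    show "totally_rankable r T P"
      using M(2) coords unfolding totally_rankable_def rankable_def by auto
    have "upset T A (\<lambda>_. 0) = A" for A :: "('a \<Rightarrow> nat) set" by (auto simp: upset_def cle_def)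
    then show "rankable T P (int r)" using M(3) coords[of _ "\<lambda>_. 0"] unfolding rankable_def by auto
    show "\<not> redundant r T P y" if "y \<in> P" for y using that red_mono by (auto simp: P_def)
  qed
  \<comment> \<open>Redundancy relative to \<open>M\<close> and to \<open>P'\<close> coincide, and
    \<open>P'\<close> has no redundant points, so \<open>P'\<close> is what remains of
    \<open>M\<close> after discarding them.\<close>
  moreover have "P' = P" if "perm_array r T P'" "M = pclosure r T P'" for P'
  proof -
    have "P' \<subseteq> arr r T" using that(1) by (simp add: perm_array_def)
    from redundant_pclosure[OF T this] that show ?thesis
      by (auto simp: P_def perm_array_def pclosure_def)
  qed
  ultimately show ?thesis using MP by blast
qed

text \<open>\<open>rk\<close> is a definite description; a single direction in \<open>T\<close>
  already determines its value. Passing to the closure lets ranks be read off the local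
  array.\<close>

lemma rank_array_eq:
  assumes T: "finite T" "T \<noteq> {}" and P: "perm_array r T P" and x: "x \<in> arr r T" and i: "i \<in> T"
  shows "rank_array T P x = int (card ((\<lambda>y. y i) ` upset T (pclosure r T P) x)) - 1"
proof -
  obtain s where s: "rankable T (upset T P x) s"
    using P x unfolding perm_array_def totally_rankable_def by blast
  have uniq: "s' = int (card ((\<lambda>y. y i) ` upset T P x)) - 1" if "rankable T (upset T P x) s'" for s'
    using that i unfolding rankable_def by force
  have "rk T (upset T P x) = s" unfolding rk_def using s uniq by (intro the_equality) metis+
  with uniq[OF s] show ?thesis unfolding rank_array_def
    using coords_upset_pclosure[OF T _ i] P by (simp add: perm_array_def)
qed

section \<open>Superlevel sets at a point\<close>

text \<open>Counterpart of \<open>upset\<close> for functions. Thresholds are slopes, not indices,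
  because slopes keep their meaning in a subseries.\<close>

definition superlevel :: "('v, 'e) mgraph \<Rightarrow> (('v, 'e) gpt \<Rightarrow> real) set \<Rightarrow> ('v, 'e) gpt
    \<Rightarrow> ('e tdir \<Rightarrow> real) \<Rightarrow> (('v, 'e) gpt \<Rightarrow> real) set" where
  "superlevel G S p c = {g\<in>S. \<forall>\<eta>\<in>tdirs G p. c \<eta> \<le> sl G g \<eta>}"

lemma superlevel_eq_if_all_slopes:
  assumes G: "metric_graph G" "p \<in> pts G" "\<eta> \<in> tdirs G p" and S: "tls G r D S"
    and card: "r + 1 \<le> card (slset G (superlevel G S p c) \<eta>)"
  shows "superlevel G S p c = S"
proof (rule ccontr)
  assume "superlevel G S p c \<noteq> S"
  then obtain g \<theta> where g: "g \<in> S" "\<theta> \<in> tdirs G p" "sl G g \<theta> < c \<theta>"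
    by (force simp: superlevel_def not_le)
  obtain B where B: "B \<subseteq> (\<lambda>g. sl G g \<eta>) ` superlevel G S p c" "finite B" "card B = r + 1"
    using obtain_subset_with_card_n[OF card] by (auto simp: slset_def)
  then obtain F where F: "F \<subseteq> superlevel G S p c" "inj_on (\<lambda>g. sl G g \<eta>) F" "B = (\<lambda>g. sl G g \<eta>) ` F"
    using subset_image_inj[of B] by metis
  then have fin: "finite F" "card F = r + 1" using B by (auto simp: card_image dest: finite_imageD)
  have F_ge: "c \<theta> \<le> sl G h \<theta>" if "h \<in> F" for h using that F(1) g(2) by (auto simp: superlevel_def)
  have "g \<notin> F" using F_ge[of g] g(3) by auto
  have FS: "insert g F \<subseteq> S" using F(1) g(1) by (auto simp: superlevel_def)
  moreover have "finite (insert g F)" "card (insert g F) = r + 2" using fin \<open>g \<notin> F\<close> by auto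
  ultimately have "tdep G (insert g F)" using S by (auto simp: tls_def)
  moreover have "pl_fun G h" if "h \<in> insert g F" for h using that FS tls_pl_fun[OF S] by blast
  ultimately obtain F0 where F0: "F0 \<subseteq> insert g F"
    "\<And>\<eta>. \<eta> \<in> tdirs G p \<Longrightarrow> \<exists>g1\<in>F0. \<exists>g2\<in>F0. g1 \<noteq> g2 \<and> sl G g1 \<eta> = sl G g2 \<eta> \<and>
       (\<forall>g\<in>F0. sl G g1 \<eta> \<le> sl G g \<eta>)" 
    using tdep_local[OF G(1,2) \<open>finite (insert g F)\<close>] by metis
  show False
  \<comment> \<open>If \<open>g\<close> is a minimiser at \<open>p\<close>, the least slope along
    \<open>\<theta>\<close> is below \<open>c \<theta>\<close>, which no second function attains.
    Otherwise two members of \<open>F\<close> share a slope along \<open>\<eta>\<close>.\<close>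
  proof (cases "g \<in> F0")
    case True
    obtain g1 g2 where "g1 \<in> F0" "g2 \<in> F0" "g1 \<noteq> g2" "sl G g1 \<theta> = sl G g2 \<theta>" "sl G g1 \<theta> \<le> sl G g \<theta>"
      using F0(2)[OF g(2)] True by blast
    with F0(1) F_ge[of g1] F_ge[of g2] g(3) show False by auto
  next
    case False
    obtain g1 g2 where "g1 \<in> F0" "g2 \<in> F0" "g1 \<noteq> g2" "sl G g1 \<eta> = sl G g2 \<eta>"
      using F0(2)[OF G(3)] by blast
    with False F0(1) F(2) show False by (auto dest: inj_onD)
  qed
qed

section \<open>Descent through strongly recursive subseries\<close>

lemma strongly_recursive_tls: "strongly_recursive G r D S \<Longrightarrow> tls G r D S"
  by (erule strongly_recursive.cases) simp

lemma strongly_recursive_subseries: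
  assumes "strongly_recursive G r D S" "r \<ge> 1" "F \<subseteq> S" "finite F" "card F = r"
  obtains T where "F \<subseteq> T" "T \<subseteq> S" "strongly_recursive G (r - 1) D T"
  using assms(1)
proof cases
  case 1
  with assms(2-5) that show ?thesis by blast
qed

lemma slset_representatives:
  obtains F where "F \<subseteq> S" "inj_on (\<lambda>g. sl G g \<eta>) F" "slset G S \<eta> = (\<lambda>g. sl G g \<eta>) ` F"
proof -
  have "slset G S \<eta> \<subseteq> (\<lambda>g. sl G g \<eta>) ` S" by (simp add: slset_def)
  then show ?thesis using that unfolding subset_image_inj by blast
qed

text \<open>Provides the induction step for superlevel sets: either the threshold is vacuous on
  \<open>S\<close>, or the rank drops by one without losing a slope along
  \<open>\<eta>\<close>.\<close>

lemma superlevel_cases: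
  assumes G: "metric_graph G" "p \<in> pts G" "\<eta> \<in> tdirs G p" and S: "strongly_recursive G r D S"
    and ne: "superlevel G S p c \<noteq> {}"
  obtains "superlevel G S p c = S"
  | T where "r \<ge> 1" "T \<subseteq> S" "strongly_recursive G (r - 1) D T"
      "slset G (superlevel G S p c) \<eta> \<subseteq> slset G (superlevel G T p c) \<eta>"
proof -
  note tls = strongly_recursive_tls[OF S]
  let ?N = "superlevel G S p c"
  have NS: "?N \<subseteq> S" by (auto simp: superlevel_def)
  then have "slset G ?N \<eta> \<subseteq> slset G S \<eta>" by (auto simp: slset_def)
  then have finN: "finite (slset G ?N \<eta>)" using card_slset(1)[OF G tls] finite_subset by blast
  show ?thesis
  proof (cases "r + 1 \<le> card (slset G ?N \<eta>)")
    case True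
    with superlevel_eq_if_all_slopes[OF G tls] that(1) show ?thesis by blast
  next
    case False
    have "card (slset G ?N \<eta>) \<noteq> 0" using ne finN by (auto simp: slset_def)
    with False have r: "r \<ge> 1" by linarith
    obtain F0 where F0: "F0 \<subseteq> ?N" "inj_on (\<lambda>g. sl G g \<eta>) F0" "slset G ?N \<eta> = (\<lambda>g. sl G g \<eta>) ` F0"
      using slset_representatives by metis
    \<comment> \<open>The recursive condition speaks of exactly \<open>r\<close> functions, so
      \<open>F0\<close> is padded from \<open>F1\<close>, which has \<open>r + 1\<close>
      elements.\<close>
    obtain F1 where F1: "F1 \<subseteq> S" "inj_on (\<lambda>g. sl G g \<eta>) F1" "slset G S \<eta> = (\<lambda>g. sl G g \<eta>) ` F1"
      using slset_representatives by metis
    have fin: "finite F0" "finite F1"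
      using finN card_slset(1)[OF G tls] F0 F1 by (auto dest: finite_imageD)
    have "card F0 \<le> r" using F0(2,3) False by (simp add: card_image)
    moreover have "card F1 = r + 1" using card_slset(2)[OF G tls] F1(2,3) by (simp add: card_image)
    then have "r \<le> card (F0 \<union> F1)" using card_mono[of "F0 \<union> F1" F1] fin by auto
    ultimately obtain F where F: "F0 \<subseteq> F" "F \<subseteq> F0 \<union> F1" "card F = r"
      using exists_subset_between[of F0 r "F0 \<union> F1"] fin by auto
    have "F \<subseteq> S" "finite F" using F(2) F0(1) F1(1) NS fin finite_subset[OF F(2)] by auto
    then obtain T where T: "F \<subseteq> T" "T \<subseteq> S" "strongly_recursive G (r - 1) D T"
      using strongly_recursive_subseries[OF S r _ _ F(3)] by blast
    have "F0 \<subseteq> superlevel G T p c" using F0(1) F(1) T(1) by (auto simp: superlevel_def)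
    then have "slset G ?N \<eta> \<subseteq> slset G (superlevel G T p c) \<eta>"
      using F0(3) by (auto simp: slset_def)
    with that(2) r T show ?thesis by blast
  qed
qed

lemma finite_slset_superlevel:
  assumes "metric_graph G" "p \<in> pts G" "\<eta> \<in> tdirs G p" "strongly_recursive G r D S"
  shows "finite (slset G (superlevel G S p c) \<eta>)"
proof (rule finite_subset)
  show "finite (slset G S \<eta>)" using card_slset(1)[OF assms(1-3) strongly_recursive_tls[OF assms(4)]] .
qed (auto simp: slset_def superlevel_def)

lemma superlevel_mono: "T \<subseteq> S \<Longrightarrow> superlevel G T p c \<subseteq> superlevel G S p c"
  by (auto simp: superlevel_def)

text \<open>All slopes along \<open>\<eta>\<close> survive in the subseries, where induction
  compares the directions, and enlarging the series back only adds slopes along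
  \<open>\<theta>\<close>. Exchanging \<open>\<eta>\<close> and \<open>\<theta>\<close> gives
  equality, which is rankability.\<close>

lemma superlevel_card_le:
  assumes "metric_graph G" "p \<in> pts G" "\<eta> \<in> tdirs G p" "\<theta> \<in> tdirs G p" "strongly_recursive G r D S"
  shows "card (slset G (superlevel G S p c) \<eta>) \<le> card (slset G (superlevel G S p c) \<theta>)"
  using assms(5)
proof (induction r arbitrary: S rule: less_induct)
  case (less r)
  show ?case
  proof (cases "superlevel G S p c = {}")
    case True
    then show ?thesis by (simp add: slset_def)
  next
    case False
    from assms(1-3) less.prems False show ?thesis
    proof (cases rule: superlevel_cases)
      case 1
      then show ?thesis
        using card_slset(2)[OF assms(1,2) _ strongly_recursive_tls[OF less.prems]] assms(3,4) by simp
    next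
      case (2 T)
      have "card (slset G (superlevel G S p c) \<eta>) \<le> card (slset G (superlevel G T p c) \<eta>)"
        using 2 assms(1-3) by (intro card_mono finite_slset_superlevel)
      also have "\<dots> \<le> card (slset G (superlevel G T p c) \<theta>)"
        using 2 by (intro less.IH[of "r - 1"]) auto
      also have "\<dots> \<le> card (slset G (superlevel G S p c) \<theta>)"
        using superlevel_mono[OF 2(2), of G p c]
        by (intro card_mono finite_slset_superlevel[OF assms(1,2,4) less.prems]) (auto simp: slset_def)
      finally show ?thesis .
    qed
  qed
qed

text \<open>The rank condition of \<open>tls\<close>, applied to \<open>r\<close> times the point
  \<open>p\<close>.\<close>

lemma tls_div_ge_multiple:
  assumes "tls G r D S" "p \<in> pts G"
  obtains g where "g \<in> S" "real_of_int (D p) + divf G g p \<ge> real r"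
proof -
  define E where "E q = (if q = p then int r else 0)" for q
  have supp: "{q. E q \<noteq> 0} = (if r = 0 then {} else {p})" by (auto simp: E_def)
  have "effective G E" unfolding effective_def is_divisor_def supp using assms(2) by (auto simp: E_def)
  moreover have "deg E = int r" unfolding deg_def supp by (auto simp: E_def)
  ultimately obtain g where "g \<in> S" "div_ge G D g E" using assms(1) unfolding tls_def by blast
  with that assms(2) show ?thesis unfolding div_ge_def by (force simp: E_def)
qed

text \<open>The descent stops at a subseries of some rank \<open>k\<close> lying entirely in the
  superlevel set. It has \<open>k + 1\<close> slopes along \<open>\<eta>\<close>, and the count
  never dropped on the way, so its rank condition at \<open>p\<close> suffices.\<close>

lemma superlevel_div_ge:
  assumes "metric_graph G" "p \<in> pts G" "\<eta> \<in> tdirs G p" "strongly_recursive G r D S"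
    and "superlevel G S p c \<noteq> {}"
  shows "\<exists>g\<in>superlevel G S p c.
    real_of_int (D p) + divf G g p \<ge> real (card (slset G (superlevel G S p c) \<eta>)) - 1"
  using assms(4,5)
proof (induction r arbitrary: S rule: less_induct)
  case (less r)
  from assms(1-3) less.prems show ?case
  proof (cases rule: superlevel_cases)
    case 1
    note tls = strongly_recursive_tls[OF less.prems(1)]
    obtain g where "g \<in> S" "real_of_int (D p) + divf G g p \<ge> real r"
      using tls_div_ge_multiple[OF tls assms(2)] by blast
    with 1 show ?thesis using card_slset(2)[OF assms(1-3) tls] by auto
  next
    case (2 T)
    have "superlevel G T p c \<noteq> {}" using 2(4) less.prems(2) by (auto simp: slset_def)
    then obtain g where g: "g \<in> superlevel G T p c"
      "real_of_int (D p) + divf G g p \<ge> real (card (slset G (superlevel G T p c) \<eta>)) - 1"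
      using less.IH[OF _ 2(3)] 2(1) by auto
    have "card (slset G (superlevel G S p c) \<eta>) \<le> card (slset G (superlevel G T p c) \<eta>)"
      using 2 assms(1-3) by (intro card_mono finite_slset_superlevel)
    with g superlevel_mono[OF 2(2), of G p c] show ?thesis by force
  qed
qed

section \<open>Local arrays\<close>

lemma tspan_min:
  assumes "f \<in> tspan G Gs" "g \<in> tspan G Gs"
  shows "(\<lambda>q. if q \<in> pts G then min (f q) (g q + k) else 0) \<in> tspan G Gs"
proof -
  obtain H1 a1 where 1: "H1 \<subseteq> Gs" "finite H1" "H1 \<noteq> {}"
    "f = (\<lambda>q. if q \<in> pts G then Min ((\<lambda>h. h q + a1 h) ` H1) else 0)"
    using assms(1) by (auto simp: tspan_def)
  obtain H2 a2 where 2: "H2 \<subseteq> Gs" "finite H2" "H2 \<noteq> {}"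
    "g = (\<lambda>q. if q \<in> pts G then Min ((\<lambda>h. h q + a2 h) ` H2) else 0)"
    using assms(2) by (auto simp: tspan_def)
  \<comment> \<open>A generator used by both functions takes the smaller of its two
    coefficients.\<close>
  define a where "a h = (if h \<in> H1 then if h \<in> H2 then min (a1 h) (a2 h + k) else a1 h
    else a2 h + k)" for h
  have "min (f q) (g q + k) = Min ((\<lambda>h. h q + a h) ` (H1 \<union> H2))" if q: "q \<in> pts G" for q
  proof (rule antisym)
    have f: "f q \<le> h q + a1 h" if "h \<in> H1" for h using that 1 q by auto
    have g: "g q \<le> h q + a2 h" if "h \<in> H2" for h using that 2 q by auto
    show "min (f q) (g q + k) \<le> Min ((\<lambda>h. h q + a h) ` (H1 \<union> H2))"
    proof (intro Min.boundedI)
      fix y assume "y \<in> (\<lambda>h. h q + a h) ` (H1 \<union> H2)"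
      then obtain h where "h \<in> H1 \<union> H2" "y = h q + a h" by auto
      with f[of h] g[of h] show "min (f q) (g q + k) \<le> y" by (auto simp: a_def min_def)
    qed (use 1 2 in auto)
    have le: "Min ((\<lambda>h. h q + a h) ` (H1 \<union> H2)) \<le> h q + a h" if "h \<in> H1 \<union> H2" for h
      using that 1(2) 2(2) by (intro Min_le) auto
    have "Min ((\<lambda>h. h q + a h) ` (H1 \<union> H2)) \<le> f q"
    proof -
      have "f q \<in> (\<lambda>h. h q + a1 h) ` H1" using 1 q Min_in[of "(\<lambda>h. h q + a1 h) ` H1"] by auto
      then obtain h where "h \<in> H1" "f q = h q + a1 h" by auto
      with le[of h] show ?thesis by (auto simp: a_def min_def split: if_splits)
    qed
    moreover have "Min ((\<lambda>h. h q + a h) ` (H1 \<union> H2)) \<le> g q + k"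
    proof -
      have "g q \<in> (\<lambda>h. h q + a2 h) ` H2" using 2 q Min_in[of "(\<lambda>h. h q + a2 h) ` H2"] by auto
      then obtain h where "h \<in> H2" "g q = h q + a2 h" by auto
      with le[of h] show ?thesis by (auto simp: a_def min_def split: if_splits)
    qed
    ultimately show "Min ((\<lambda>h. h q + a h) ` (H1 \<union> H2)) \<le> min (f q) (g q + k)" by simp
  qed
  then have "(\<lambda>q. if q \<in> pts G then min (f q) (g q + k) else 0) =
     (\<lambda>q. if q \<in> pts G then Min ((\<lambda>h. h q + a h) ` (H1 \<union> H2)) else 0)" by auto
  then show ?thesis unfolding tspan_def
    using 1(1-3) 2(1-3) by (intro CollectI exI[of _ "H1 \<union> H2"] exI[of _ a]) auto
qed

text \<open>Supplies the closure of the local array under minima that \<open>ex1_perm_array\<close>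
  requires.\<close>

lemma tls_min_slopes:
  assumes G: "metric_graph G" "p \<in> pts G" and S: "tls G r D S" and "f \<in> S" "g \<in> S"
  obtains h where "h \<in> S" "\<And>\<eta>. \<eta> \<in> tdirs G p \<Longrightarrow> sl G h \<eta> = min (sl G f \<eta>) (sl G g \<eta>)"
proof -
  \<comment> \<open>The shift makes both functions agree at \<open>p\<close>, so that near
    \<open>p\<close> the smaller slope decides in every direction.\<close>
  define h where "h = (\<lambda>q. if q \<in> pts G then min (f q) (g q + (f p - g p)) else 0)"
  obtain Gs where "S = tspan G Gs" using S unfolding tls_def by blast
  then have "h \<in> S" using tspan_min assms(4,5) unfolding h_def by blast
  moreover have "sl G h \<eta> = min (sl G f \<eta>) (sl G g \<eta>)" if \<eta>: "\<eta> \<in> tdirs G p" for \<eta>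
  proof (rule sl_eqI)
    show "eventually (\<lambda>t. h (ray G \<eta> t) = h (ray G \<eta> 0) + min (sl G f \<eta>) (sl G g \<eta>) * t) (at_right 0)"
      using eventually_germ[OF G \<eta> tls_pl_fun[OF S \<open>f \<in> S\<close>]]
        eventually_germ[OF G \<eta> tls_pl_fun[OF S \<open>g \<in> S\<close>]]
        eventually_ray_in_pts[OF G \<eta>] eventually_at_right_less[of 0]
    proof eventually_elim
      case (elim t)
      have "min (sl G f \<eta>) (sl G g \<eta>) * t = min (sl G f \<eta> * t) (sl G g \<eta> * t)"
        using elim(4) by (simp add: min_mult_distrib_right)
      with elim G(2) show ?case by (simp add: h_def ray_0[OF G \<eta>] min_def del: sl.simps)
    qed
  qed
  ultimately show ?thesis using that by blast
qed

text \<open>The superlevel sets of \<open>S\<close> correspond to the upsets of the local array, so equal slope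
  counts in all directions are what total rankability of the local array means.\<close>
lemma local_rank_eq:
  assumes G: "metric_graph G" "p \<in> pts G" "\<eta> \<in> tdirs G p" and S: "strongly_recursive G r D S"
    and f: "f \<in> S"
  shows "local_rank G r S p f = int (card (slset G (superlevel G S p (sl G f)) \<eta>)) - 1"
proof -
  note tls = strongly_recursive_tls[OF S]
  let ?T = "tdirs G p" and ?M = "local_array G S p"
  \<comment> \<open>In each direction at \<open>p\<close>, \<open>idx\<close> is the order
    isomorphism from the slope set onto \<open>{..r}\<close>.\<close>
  define idx where "idx i s = card {s' \<in> slset G S i. s' < s}" for i s
  have assoc: "assoc_pt G S p g i = (if i \<in> ?T then idx i (sl G g i) else 0)" for g i
    by (simp add: assoc_pt_def idx_def)
  note fin = card_slset(1)[OF G(1,2) _ tls] and card = card_slset(2)[OF G(1,2) _ tls]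
  have idx_less: "idx i s < idx i s'" if "i \<in> ?T" "s \<in> slset G S i" "s < s'" for i s s'
    unfolding idx_def using that fin[OF that(1)] by (intro psubset_card_mono) auto
  have idx_mono: "idx i s \<le> idx i s'" if "i \<in> ?T" "s \<le> s'" for i s s'
    unfolding idx_def using that fin[OF that(1)] by (intro card_mono) auto
  have idx_le_iff: "idx i s \<le> idx i s' \<longleftrightarrow> s \<le> s'" if "i \<in> ?T" "s \<in> slset G S i" "s' \<in> slset G S i" for i s s'
    using idx_less[OF that(1,3)] idx_mono[OF that(1)] by (meson leD le_less_linear)
  have idx_inj: "inj_on (idx i) (slset G S i)" if "i \<in> ?T" for i
    by (rule inj_onI) (metis idx_le_iff[OF that] antisym order_refl)
  have idx_r: "idx i s \<le> r" if "i \<in> ?T" "s \<in> slset G S i" for i s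
  proof -
    have "idx i s < card (slset G S i)"
      unfolding idx_def using that fin[OF that(1)] by (intro psubset_card_mono) auto
    with card[OF that(1)] show ?thesis by simp
  qed
  have idx_surj: "idx i ` slset G S i = {..r}" if "i \<in> ?T" for i
    using idx_r[OF that] card_image[OF idx_inj[OF that]] card[OF that]
    by (intro card_subset_eq) auto
  have sl_in: "sl G g i \<in> slset G S i" if "g \<in> S" for g i using that by (simp add: slset_def)
  have Marr: "?M \<subseteq> arr r ?T"
    using idx_r sl_in by (auto simp: local_array_def arr_def assoc)
  have T: "finite ?T" "?T \<noteq> {}" using finite_tdirs[OF G(1)] G(3) by auto
  \<comment> \<open>\<open>c\<close> lists the slopes whose indices are \<open>x\<close>; as
    \<open>idx i\<close> is injective on slopes, both sides count the same values.\<close>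
  have upset: "card ((\<lambda>y. y i) ` upset ?T ?M x) = card (slset G (superlevel G S p c) i)"
    if i: "i \<in> ?T" and c: "\<And>j. j \<in> ?T \<Longrightarrow> c j \<in> slset G S j \<and> idx j (c j) = x j" for i x c
  proof -
    have "cle ?T x (assoc_pt G S p g) \<longleftrightarrow> (\<forall>j\<in>?T. c j \<le> sl G g j)" if g: "g \<in> S" for g
      unfolding cle_def
    proof (rule ball_cong[OF refl])
      fix j assume j: "j \<in> ?T"
      show "x j \<le> assoc_pt G S p g j \<longleftrightarrow> c j \<le> sl G g j"
        using idx_le_iff[OF j _ sl_in[OF g], of "c j"] c[OF j] j by (simp add: assoc)
    qed
    then have "upset ?T ?M x = assoc_pt G S p ` superlevel G S p c"
      unfolding upset_def local_array_def superlevel_def by blast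
    then have "(\<lambda>y. y i) ` upset ?T ?M x = idx i ` slset G (superlevel G S p c) i"
      using i by (simp add: image_image assoc slset_def del: sl.simps)
    moreover have "slset G (superlevel G S p c) i \<subseteq> slset G S i"
      by (auto simp: slset_def superlevel_def)
    ultimately show ?thesis
      using inj_on_subset[OF idx_inj[OF i]] by (simp add: card_image)
  qed
  have "totally_rankable r ?T ?M" unfolding totally_rankable_def
  proof
    fix x assume "x \<in> arr r ?T"
    then have "x j \<in> idx j ` slset G S j" if "j \<in> ?T" for j
      using that idx_surj[OF that] by (auto simp: arr_def)
    then have "\<forall>j\<in>?T. \<exists>s. s \<in> slset G S j \<and> idx j s = x j" by force
    then obtain c where c: "\<And>j. j \<in> ?T \<Longrightarrow> c j \<in> slset G S j \<and> idx j (c j) = x j" by metis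
    have "card (slset G (superlevel G S p c) i) = card (slset G (superlevel G S p c) \<eta>)"
      if "i \<in> ?T" for i
      using that G S by (intro antisym superlevel_card_le)
    with upset[OF _ c] show "\<exists>s. rankable ?T (upset ?T ?M x) s"
      by (intro exI[of _ "int (card (slset G (superlevel G S p c) \<eta>)) - 1"])
        (simp add: rankable_def)
  qed
  moreover have "rankable ?T ?M (int r)" unfolding rankable_def
  proof
    fix i assume i: "i \<in> ?T"
    have "(\<lambda>y. y i) ` ?M = idx i ` slset G S i"
      using i by (simp add: local_array_def image_image assoc slset_def del: sl.simps)
    then show "int (card ((\<lambda>y. y i) ` ?M)) = int r + 1" using idx_surj[OF i] by simp
  qed
  moreover have "(\<lambda>i. min (x i) (y i)) \<in> ?M" if xy: "x \<in> ?M" "y \<in> ?M" for x y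
  proof -
    obtain g g' where g: "g \<in> S" "x = assoc_pt G S p g" "g' \<in> S" "y = assoc_pt G S p g'"
      using xy by (auto simp: local_array_def)
    obtain h where h: "h \<in> S" "\<And>\<eta>. \<eta> \<in> ?T \<Longrightarrow> sl G h \<eta> = min (sl G g \<eta>) (sl G g' \<eta>)"
      using tls_min_slopes[OF G(1,2) tls g(1,3)] by blast
    have "(\<lambda>i. min (x i) (y i)) = assoc_pt G S p h"
    proof
      fix i
      show "min (x i) (y i) = assoc_pt G S p h i"
        using h(2)[of i] idx_mono[of i "sl G g i" "sl G g' i"] idx_mono[of i "sl G g' i" "sl G g i"]
        by (auto simp: g assoc min_def simp del: sl.simps)
    qed
    with h(1) show ?thesis by (simp add: local_array_def)
  qed
  \<comment> \<open>Unique existence is what gives the definite description in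
    \<open>local_perm_array\<close> its meaning.\<close>
  ultimately have "\<exists>!P. perm_array r ?T P \<and> ?M = pclosure r ?T P"
    using ex1_perm_array[OF T Marr] by blast
  from theI'[OF this] have P: "perm_array r ?T (local_perm_array G r S p)"
    "?M = pclosure r ?T (local_perm_array G r S p)"
    unfolding local_perm_array_def by blast+
  have "assoc_pt G S p f \<in> arr r ?T" using Marr f by (auto simp: local_array_def)
  from rank_array_eq[OF T P(1) this G(3)] upset[OF G(3), of "sl G f"] sl_in[OF f]
  show ?thesis unfolding local_rank_def P(2)[symmetric] by (simp add: assoc)
qed

theorem mainTheorem7:
  fixes G :: "('v, 'e) mgraph" and r :: nat
    and D E :: "('v, 'e) gpt \<Rightarrow> int" and S :: "(('v, 'e) gpt \<Rightarrow> real) set"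
    and f :: "('v, 'e) gpt \<Rightarrow> real"
  assumes "metric_graph G"
    and "strongly_recursive G r D S"
    and "effective G E" and "deg E \<le> int r"
    and "f \<in> S"
    and "\<forall>p\<in>pts G. local_rank G r S p f \<ge> E p"
  shows "div_ge G D f E"
  unfolding div_ge_def
proof
  fix p assume p: "p \<in> pts G"
  note tls = strongly_recursive_tls[OF assms(2)]
  show "real_of_int (E p) \<le> real_of_int (D p) + divf G f p"
  proof (cases "tdirs G p = {}")
    \<comment> \<open>\<open>G\<close> is a single point, where \<open>local_rank\<close> is a junk value.\<close>
    case True
    have E: "finite {q. E q \<noteq> 0}" "\<And>q. E q \<ge> 0"
      using assms(3) by (auto simp: effective_def is_divisor_def)
    \<comment> \<open>Effectivity gives \<open>E p \<le> deg E \<le> r\<close>. Without tangent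
      directions \<open>divf\<close> is an empty sum, so the rank condition reads
      \<open>D p \<ge> r\<close>.\<close>
    have "E p \<le> deg E"
    proof (cases "E p = 0")
      case True
      then show ?thesis using E by (auto simp: deg_def intro: sum_nonneg)
    next
      case False
      then show ?thesis unfolding deg_def using E by (intro member_le_sum) auto
    qed
    moreover obtain g where "real_of_int (D p) + divf G g p \<ge> real r"
      using tls_div_ge_multiple[OF tls p] by blast
    ultimately show ?thesis using True assms(4) by (simp add: divf_def)
  next
    case False
    then obtain \<eta> where \<eta>: "\<eta> \<in> tdirs G p" by blast
    let ?N = "superlevel G S p (sl G f)"
    have "?N \<noteq> {}" using assms(5) by (auto simp: superlevel_def)
    then obtain g where g: "g \<in> ?N"
      "real_of_int (D p) + divf G g p \<ge> real (card (slset G ?N \<eta>)) - 1"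
      using superlevel_div_ge[OF assms(1) p \<eta> assms(2)] by blast
    have "(\<Sum>\<eta>\<in>tdirs G p. sl G f \<eta>) \<le> (\<Sum>\<eta>\<in>tdirs G p. sl G g \<eta>)"
      using g(1) by (intro sum_mono) (auto simp: superlevel_def)
    then have "divf G g p \<le> divf G f p" by (simp add: divf_def)
    moreover have "E p \<le> int (card (slset G ?N \<eta>)) - 1"
      using assms(6) p local_rank_eq[OF assms(1) p \<eta> assms(2,5)] by auto
    ultimately show ?thesis using g(2) by linarith
  qed
qed

end
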